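(* For each $n\ge 1$, let $D_n$ be the number of descents of a matching chosen uniformly at random from the set of matchings in $S_{2n}$, and let $$W_n=\frac{D_n-n}{\sqrt{n}} .$$ Then, as $n\to\infty$, $W_n$ converges in distribution to the normal distribution with mean $0$ and variance $\frac16$, i.e. $W_n \Rightarrow \mathcal{N}\left(0,\frac16\right)$.
   Context: A matching (fixed point free involution) in $S_{2n}$ is a permutation $\pi\in S_{2n}$ with $\pi^2=1$ and $\pi(i)\neq i$ for all $i=1,\dots,2n$. A permutation $\pi\in S_{2n}$ has a descent at position $i$ ($1\le i\le 2n-1$) if $\pi(i)>\pi(i+1)$. The number of descents of $\pi$ is the number of such positions $i$ (with no $1$ added). *)

theory Defs
  imports "HOL-Probability.Probability" "HOL-Combinatorics.Permutations"
begin

text \<open>Permutations in the symmetric group on m letters are represented as functions permuting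
  {1..m} that fix every other natural number.\<close>

definition matchings :: "nat \<Rightarrow> (nat \<Rightarrow> nat) set" where
  "matchings n = {p. p permutes {1..2 * n} \<and> p \<circ> p = id \<and> (\<forall>i\<in>{1..2 * n}. p i \<noteq> i)}"

definition num_descents :: "nat \<Rightarrow> (nat \<Rightarrow> nat) \<Rightarrow> nat" where
  "num_descents m p = card {i \<in> {1..m - 1}. p i > p (i + 1)}"

definition W :: "nat \<Rightarrow> (nat \<Rightarrow> nat) \<Rightarrow> real" where
  "W n p = (real (num_descents (2 * n) p) - real n) / sqrt (real n)"

text \<open>The uniform distribution \<open>pmf_of_set\<close> is only specified for finite nonempty sets.\<close>

lemma finite_matchings: "finite (matchings n)"
  by (rule finite_subset[OF _ finite_permutations[of "{1..2 * n}"]]) (auto simp: matchings_def)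

lemma matchings_nonempty: "matchings n \<noteq> {}"
proof -
  define p where "p = (\<lambda>i::nat. if i \<in> {1..2 * n} then (if odd i then i + 1 else i - 1) else i)"
  have pp: "p (p i) = i" for i
  proof (cases "odd i")
    case True
    then show ?thesis
      by (auto simp: p_def) presburger
  next
    case False
    then show ?thesis
      by (auto simp: p_def elim!: evenE)
  qed
  have "p permutes {1..2 * n}"
    unfolding permutes_def
  proof (intro conjI allI impI)
    show "p x = x" if "x \<notin> {1..2 * n}" for x
      using that unfolding p_def by (rule if_not_P)
    show "\<exists>!x. p x = y" for y
      by (metis pp)
  qed
  moreover have "p \<circ> p = id"
    using pp by auto
  moreover have "\<forall>i\<in>{1..2 * n}. p i \<noteq> i"
    by (auto simp: p_def)
  ultimately show ?thesis
    by (auto simp: matchings_def)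
qed

end

theory Submission
  imports Defs "HOL-Real_Asymp.Real_Asymp"
begin

text \<open>Pair a matching \<open>p\<close> with a word \<open>w\<close> over \<open>{0..r}\<close> that is weakly increasing and
  strictly increasing at the descents of \<open>p\<close>. The edges \<open>{w i, w (p i)}\<close> form a loopless
  multigraph with \<open>n\<close> edges, which determines the pair: listing its half-edges
  lexicographically recovers \<open>w\<close>, and swapping the two ends of each edge recovers \<open>p\<close>. Hence
  \<open>\<Sum>\<^sub>p t ^ des p = (1 - t) ^ (2 n + 1) \<Sum>\<^sub>r t ^ r \<Prod>\<^bsub>k<n\<^esub> (r\<^sup>2 + r + 2 k) / (2 ^ n n!)\<close>.
  Expanding the product in powers of \<open>r\<close> gives a positive combination of Eulerian polynomials;
  for \<open>t = exp (- z)\<close> with \<open>z = O (1 / sqrt n)\<close> the leading one, of order \<open>2 n\<close>, dominates,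
  and it is close to \<open>((1 - t) / z) ^ (2 n + 1)\<close>. Letting \<open>z\<close> tend to the imaginary axis gives
  the characteristic function of \<open>W n\<close> up to \<open>o(1)\<close>, and Levy's theorem applies.\<close>

subsection \<open>Words with prescribed strict ascents\<close>

definition step_words :: "nat set \<Rightarrow> nat \<Rightarrow> nat \<Rightarrow> (nat \<Rightarrow> nat) set" where
  "step_words D N r = {w \<in> {1..N} \<rightarrow>\<^sub>E {..r}.
     \<forall>i\<in>{1..<N}. w i \<le> w (Suc i) \<and> (i \<in> D \<longrightarrow> w i < w (Suc i))}"

lemma finite_step_words: "finite (step_words D N r)"
  unfolding step_words_def by (rule finite_subset[OF _ finite_PiE[of "{1..N}" "\<lambda>_. {..r}"]]) auto

lemma step_words_mono:
  assumes "w \<in> step_words D N r" "1 \<le> i" "i \<le> j" "j \<le> N"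
  shows "w i \<le> w j"
  using assms(3,4)
proof (induction j rule: dec_induct)
  case (step j)
  then have "w j \<le> w (Suc j)"
    using assms(1,2) by (auto simp: step_words_def)
  then show ?case using step by simp
qed simp

text \<open>Splitting off the last letter \<open>v\<close>: by monotonicity the other letters only
  have to be at most \<open>v - \<delta>\<close>, where \<open>\<delta>\<close> is 1 if a strict
  ascent is demanded at \<open>N\<close>. Since \<open>v\<close> starts at \<open>\<delta>\<close>,
  this subtraction never truncates.\<close>

lemma bij_betw_step_words_Suc:
  fixes D N
  defines "\<delta> \<equiv> (if N \<in> D \<inter> {1..<Suc N} then 1 else 0 :: nat)"
  shows "bij_betw (\<lambda>w. (w (Suc N), restrict w {1..N})) (step_words D (Suc N) r)
    (SIGMA v:{\<delta>..r}. step_words D N (v - \<delta>))"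
proof (rule bij_betw_byWitness[where f' = "\<lambda>(v, w). w(Suc N := v)"])
  show "\<forall>w\<in>step_words D (Suc N) r.
      (case (w (Suc N), restrict w {1..N}) of (v, w) \<Rightarrow> w(Suc N := v)) = w"
    by (auto simp: step_words_def PiE_def extensional_def fun_eq_iff)
  show "\<forall>x\<in>SIGMA v:{\<delta>..r}. step_words D N (v - \<delta>).
      ((case x of (v, w) \<Rightarrow> w(Suc N := v)) (Suc N),
        restrict (case x of (v, w) \<Rightarrow> w(Suc N := v)) {1..N}) = x"
    by (auto simp: step_words_def PiE_def extensional_def fun_eq_iff)
  show "(\<lambda>w. (w (Suc N), restrict w {1..N})) ` step_words D (Suc N) r
      \<subseteq> (SIGMA v:{\<delta>..r}. step_words D N (v - \<delta>))"
  proof (clarify, intro conjI SigmaI)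
    fix w assume w: "w \<in> step_words D (Suc N) r"
    have r: "w (Suc N) \<le> r" using w by (auto simp: step_words_def PiE_def Pi_def)
    have top: "w i + \<delta> \<le> w (Suc N)" if "i \<in> {1..N}" for i
    proof -
      have "w i \<le> w N" using step_words_mono[OF w, of i N] that by auto
      moreover have "w N + \<delta> \<le> w (Suc N)"
        using w that by (auto simp: step_words_def \<delta>_def)
      ultimately show ?thesis by simp
    qed
    have "\<delta> \<le> w (Suc N)"
      using top[of N] by (cases "N = 0") (auto simp: \<delta>_def)
    then show "w (Suc N) \<in> {\<delta>..r}" using r by simp
    have "restrict w {1..N} \<in> {1..N} \<rightarrow>\<^sub>E {..w (Suc N) - \<delta>}"
      using top by (fastforce simp: PiE_def Pi_def)
    then show "restrict w {1..N} \<in> step_words D N (w (Suc N) - \<delta>)"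
      using w by (auto simp: step_words_def)
  qed
  show "(\<lambda>(v, w). w(Suc N := v)) ` (SIGMA v:{\<delta>..r}. step_words D N (v - \<delta>))
      \<subseteq> step_words D (Suc N) r"
  proof clarify
    fix v w assume v: "v \<in> {\<delta>..r}" and w: "w \<in> step_words D N (v - \<delta>)"
    have b: "w i \<le> v - \<delta>" if "i \<in> {1..N}" for i
      using w that by (auto simp: step_words_def PiE_def Pi_def)
    have b': "w i + \<delta> \<le> v" if "i \<in> {1..N}" for i
      using b[OF that] v by auto
    have "w(Suc N := v) \<in> {1..Suc N} \<rightarrow>\<^sub>E {..r}"
    proof (rule PiE_I)
      fix i assume "i \<in> {1..Suc N}"
      then show "(w(Suc N := v)) i \<in> {..r}"
        using v b'[of i] by (cases "i = Suc N") auto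
    next
      fix i assume "i \<notin> {1..Suc N}"
      then show "(w(Suc N := v)) i = undefined"
        using w by (auto simp: step_words_def PiE_def extensional_def)
    qed
    moreover have "(w(Suc N := v)) i \<le> (w(Suc N := v)) (Suc i) \<and>
        (i \<in> D \<longrightarrow> (w(Suc N := v)) i < (w(Suc N := v)) (Suc i))" if i: "i \<in> {1..<Suc N}" for i
    proof (cases "i = N")
      case True
      then show ?thesis using b'[of N] i by (auto simp: \<delta>_def)
    next
      case False
      then show ?thesis using w i by (auto simp: step_words_def)
    qed
    ultimately show "w(Suc N := v) \<in> step_words D (Suc N) r"
      by (auto simp: step_words_def)
  qed
qed

text \<open>The last letter ranges over an interval, so the hockey-stick identity drives the
  induction. When \<open>r\<close> is below the number of demanded ascents, the upper index is less
  than \<open>N\<close> and the coefficient is 0.\<close>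

lemma card_step_words:
  "card (step_words D N r) = (r + N - card (D \<inter> {1..<N})) choose N"
proof (induction N arbitrary: r)
  case 0
  have "step_words D 0 r = {\<lambda>_. undefined}"
    by (auto simp: step_words_def)
  then show ?case by simp
next
  case (Suc N)
  define \<delta> where "\<delta> = (if N \<in> D \<inter> {1..<Suc N} then 1 else 0 :: nat)"
  define d where "d = card (D \<inter> {1..<N})"
  have d: "d \<le> N - 1"
    unfolding d_def by (rule order_trans[OF card_mono[of "{1..<N}"]]) auto
  have "D \<inter> {1..<Suc N} = (if N \<in> D \<inter> {1..<Suc N} then insert N (D \<inter> {1..<N}) else D \<inter> {1..<N})"
    by (auto simp: less_Suc_eq)
  then have d': "card (D \<inter> {1..<Suc N}) = d + \<delta>"
    by (auto simp: d_def \<delta>_def)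
  have \<delta>: "\<delta> \<le> 1" "d + \<delta> \<le> N"
    using d by (auto simp: \<delta>_def)
  have "card (step_words D (Suc N) r) = (\<Sum>v=\<delta>..r. card (step_words D N (v - \<delta>)))"
    using bij_betw_same_card[OF bij_betw_step_words_Suc[of N D r, folded \<delta>_def]]
    by (simp add: finite_step_words)
  also have "\<dots> = (\<Sum>v=\<delta>..r. (v - \<delta> + N - d) choose N)"
    by (simp add: Suc.IH d_def)
  also have "\<dots> = (r + Suc N - (d + \<delta>)) choose Suc N"
  proof (cases "\<delta> \<le> r")
    case True
    have "(\<Sum>v=\<delta>..r. (v - \<delta> + N - d) choose N) = (\<Sum>k=N-d..r - \<delta> + N - d. k choose N)"
      using True d
      by (intro sum.reindex_bij_witness[of _ "\<lambda>k. k + \<delta> + d - N" "\<lambda>v. v - \<delta> + N - d"]) auto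
    \<comment> \<open>The added terms have \<open>k < N - d\<close>, so \<open>k choose N\<close>
      vanishes.\<close>
    also have "\<dots> = (\<Sum>k\<le>r - \<delta> + N - d. k choose N)"
      by (intro sum.mono_neutral_left) (auto simp: not_le intro!: binomial_eq_0)
    also have "\<dots> = Suc (r - \<delta> + N - d) choose Suc N"
      by (rule sum_choose_upper)
    also have "Suc (r - \<delta> + N - d) = r + Suc N - (d + \<delta>)"
      using True d by simp
    finally show ?thesis .
  next
    case False
    then show ?thesis using \<delta> d by (auto simp: binomial_eq_0)
  qed
  finally show ?case by (simp only: d')
qed

subsection \<open>Positions in the lexicographic order\<close>

definition lex3 :: "(nat \<times> nat \<times> nat) rel" where
  "lex3 = less_than <*lex*> less_than <*lex*> less_than"

lemma lex3_iff [simp]: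
  "((a, b, k), (a', b', k')) \<in> lex3 \<longleftrightarrow> a < a' \<or> a = a' \<and> (b < b' \<or> b = b' \<and> k < k')"
  by (simp add: lex3_def)

definition lex_pos :: "(nat \<times> nat \<times> nat) set \<Rightarrow> nat \<times> nat \<times> nat \<Rightarrow> nat" where
  "lex_pos E e = Suc (card {x \<in> E. (x, e) \<in> lex3})"

lemma lex3_irrefl: "(x, x) \<notin> lex3"
  by (cases x) auto

lemma lex3_trans: "(x, y) \<in> lex3 \<Longrightarrow> (y, z) \<in> lex3 \<Longrightarrow> (x, z) \<in> lex3"
  by (cases x; cases y; cases z) auto

lemma lex3_total: "x \<noteq> y \<Longrightarrow> (x, y) \<in> lex3 \<or> (y, x) \<in> lex3"
  by (cases x; cases y) auto

lemma lex_pos_strict_mono: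
  assumes "finite E" "x \<in> E" "(x, y) \<in> lex3"
  shows "lex_pos E x < lex_pos E y"
proof -
  have "{z \<in> E. (z, x) \<in> lex3} \<subset> {z \<in> E. (z, y) \<in> lex3}"
    using assms lex3_trans lex3_irrefl[of x] by blast
  then show ?thesis
    unfolding lex_pos_def Suc_less_eq using assms(1) by (intro psubset_card_mono) auto
qed

lemma lex_pos_less_iff:
  assumes "finite E" "x \<in> E" "y \<in> E"
  shows "lex_pos E x < lex_pos E y \<longleftrightarrow> (x, y) \<in> lex3"
  using assms lex_pos_strict_mono[of E x y] lex_pos_strict_mono[of E y x] lex3_total[of x y] by fastforce

lemma bij_betw_lex_pos:
  assumes "finite E"
  shows "bij_betw (lex_pos E) E {1..card E}"
proof -
  have inj: "inj_on (lex_pos E) E"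
    using lex_pos_strict_mono[OF assms] lex3_total by (metis inj_onI less_irrefl_nat)
  have "lex_pos E e \<le> card E" if "e \<in> E" for e
  proof -
    have "{x \<in> E. (x, e) \<in> lex3} \<subset> E"
      using that lex3_irrefl[of e] by blast
    then show ?thesis
      unfolding lex_pos_def Suc_le_eq using assms by (intro psubset_card_mono)
  qed
  then have "lex_pos E ` E \<subseteq> {1..card E}"
    by (auto simp: lex_pos_def)
  then have "lex_pos E ` E = {1..card E}"
    by (intro card_subset_eq) (auto simp: card_image[OF inj])
  then show ?thesis using inj by (simp add: bij_betw_def)
qed

text \<open>Below \<open>\<phi> i\<close> lie exactly the values at the \<open>i - 1\<close> smaller
  indices. This identifies any increasing enumeration with the ranking.\<close>

lemma lex_pos_bij_mono:
  assumes bij: "bij_betw \<phi> {1..N} E"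
    and mono: "\<And>i j. 1 \<le> i \<Longrightarrow> i < j \<Longrightarrow> j \<le> N \<Longrightarrow> (\<phi> i, \<phi> j) \<in> lex3"
    and i: "i \<in> {1..N}"
  shows "lex_pos E (\<phi> i) = i"
proof -
  have "{x \<in> E. (x, \<phi> i) \<in> lex3} = \<phi> ` {1..<i}"
  proof (intro set_eqI iffI)
    fix x assume x: "x \<in> {x \<in> E. (x, \<phi> i) \<in> lex3}"
    then obtain j where j: "j \<in> {1..N}" "x = \<phi> j"
      using bij by (auto simp: bij_betw_def)
    have lt: "(\<phi> j, \<phi> i) \<in> lex3" using x j by simp
    have "j \<noteq> i" using lt lex3_irrefl[of "\<phi> i"] by metis
    moreover have "\<not> i < j"
      using mono[of i j] lex3_trans[OF lt, of "\<phi> j"] lex3_irrefl[of "\<phi> j"] j i by auto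
    ultimately have "j < i" by simp
    then show "x \<in> \<phi> ` {1..<i}" using j by auto
  next
    fix x assume "x \<in> \<phi> ` {1..<i}"
    then obtain j where j: "j \<in> {1..<i}" "x = \<phi> j" by blast
    then have "(\<phi> j, \<phi> i) \<in> lex3" using mono[of j i] i by simp
    moreover have "\<phi> j \<in> E" using bij_betwE[OF bij] i j by auto
    ultimately show "x \<in> {x \<in> E. (x, \<phi> i) \<in> lex3}" using j by simp
  qed
  moreover have "inj_on \<phi> {1..<i}"
    by (rule inj_on_subset[OF bij_betw_imp_inj_on[OF bij]]) (use i in auto)
  ultimately show ?thesis
    using i by (simp add: lex_pos_def card_image)
qed

subsection \<open>Matchings and multigraphs\<close>

text \<open>Multigraph edges are stored with the smaller end first. Copy \<open>k\<close> of an edge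
  yields one half-edge per orientation; its first component is the vertex at which it sits.\<close>

definition half_edges :: "(nat \<times> nat) multiset \<Rightarrow> (nat \<times> nat \<times> nat) set" where
  "half_edges M = {(a, b, k). k < count M (min a b, max a b)}"

definition twin :: "nat \<times> nat \<times> nat \<Rightarrow> nat \<times> nat \<times> nat" where
  "twin = (\<lambda>(a, b, k). (b, a, k))"

lemma twin_simp [simp]: "twin (a, b, k) = (b, a, k)"
  by (simp add: twin_def)

lemma twin_twin [simp]: "twin (twin e) = e"
  by (cases e) auto

lemma twin_half_edges: "e \<in> half_edges M \<Longrightarrow> twin e \<in> half_edges M"
  by (cases e) (auto simp: half_edges_def min.commute max.commute)

text \<open>Because \<open>a < b\<close> on all edges, the two orientations \<open>f\<close> and
  \<open>g\<close> of the copies are disjoint. A loop would yield only one half-edge per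
  copy.\<close>

lemma
  assumes "set_mset M \<subseteq> {(a, b). a < b}"
  shows finite_half_edges: "finite (half_edges M)"
    and card_half_edges: "card (half_edges M) = 2 * size M"
proof -
  define S where "S = (SIGMA e:set_mset M. {..<count M e})"
  have cS: "finite S" "card S = size M"
    by (auto simp: S_def size_multiset_overloaded_eq)
  define f where "f = (\<lambda>((a::nat, b::nat), k::nat). (a, b, k))"
  define g where "g = (\<lambda>((a::nat, b::nat), k::nat). (b, a, k))"
  have inj: "inj_on f S" "inj_on g S" by (auto simp: inj_on_def f_def g_def)
  have eq: "half_edges M = f ` S \<union> g ` S"
  proof (intro set_eqI iffI)
    fix e assume e: "e \<in> half_edges M"
    obtain a b k where abk: "e = (a, b, k)" by (cases e)
    have k: "k < count M (min a b, max a b)" using e by (simp add: abk half_edges_def)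
    then have "(min a b, max a b) \<in># M" by (metis gr_implies_not0 not_in_iff)
    with assms have ne: "min a b < max a b" "(min a b, max a b) \<in># M" by auto
    show "e \<in> f ` S \<union> g ` S"
    proof (cases "a < b")
      case True
      then have "((a, b), k) \<in> S" using k ne by (auto simp: S_def)
      then show ?thesis by (force simp: f_def abk)
    next
      case False
      then have "((b, a), k) \<in> S" using k ne by (auto simp: S_def min_def max_def split: if_splits)
      then show ?thesis by (force simp: g_def abk)
    qed
  next
    fix e assume "e \<in> f ` S \<union> g ` S"
    then show "e \<in> half_edges M"
      using assms by (auto simp: S_def f_def g_def half_edges_def min_def max_def)
  qed
  have disj: "f ` S \<inter> g ` S = {}"
  proof -
    have "a < b" if "((a, b), k) \<in> S" for a b k using assms that by (auto simp: S_def)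
    then have "f x \<noteq> g y" if "x \<in> S" "y \<in> S" for x y
      using that by (cases x; cases y) (fastforce simp: f_def g_def)
    then show ?thesis by blast
  qed
  show "finite (half_edges M)" using cS by (simp add: eq)
  show "card (half_edges M) = 2 * size M"
    unfolding eq using cS disj inj by (simp add: card_Un_disjoint card_image)
qed

section \<open>From a matching with a word to a multigraph\<close>

definition descents :: "nat \<Rightarrow> (nat \<Rightarrow> nat) \<Rightarrow> nat set" where
  "descents n p = {i \<in> {1..2 * n - 1}. p i > p (i + 1)}"

definition compatible :: "nat \<Rightarrow> nat \<Rightarrow> ((nat \<Rightarrow> nat) \<times> (nat \<Rightarrow> nat)) set" where
  "compatible n r = (SIGMA p:matchings n. step_words (descents n p) (2 * n) r)"

text \<open>The last component counts the earlier positions with the same first two components, so that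
  the positions of a matching become the half-edges of a multigraph on the letters, in
  lexicographic order.\<close>

definition label :: "(nat \<Rightarrow> nat) \<Rightarrow> (nat \<Rightarrow> nat) \<Rightarrow> nat \<Rightarrow> nat \<times> nat \<times> nat" where
  "label p w i = (w i, w (p i), card {j \<in> {1..<i}. w j = w i \<and> w (p j) = w (p i)})"

text \<open>Restricting to \<open>w i < w (p i)\<close> counts each edge once, at its smaller end;
  for compatible pairs \<open>compat_no_loop\<close> ensures that no edge is lost.\<close>

definition edge_mset :: "nat \<Rightarrow> (nat \<Rightarrow> nat) \<times> (nat \<Rightarrow> nat) \<Rightarrow> (nat \<times> nat) multiset" where
  "edge_mset n = (\<lambda>(p, w). image_mset (\<lambda>i. (w i, w (p i)))
     (mset_set {i \<in> {1..2 * n}. w i < w (p i)}))"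

context
  fixes n r :: nat and p w :: "nat \<Rightarrow> nat"
  assumes pw: "(p, w) \<in> compatible n r"
begin

lemma
  shows compat_perm: "p permutes {1..2 * n}"
    and compat_invol: "p (p i) = i"
    and compat_fixfree: "i \<in> {1..2 * n} \<Longrightarrow> p i \<noteq> i"
    and compat_word: "w \<in> step_words (descents n p) (2 * n) r"
  using pw by (simp_all add: compatible_def matchings_def fun_eq_iff)

lemma compat_in: "i \<in> {1..2 * n} \<Longrightarrow> p i \<in> {1..2 * n}"
  by (simp only: permutes_in_image[OF compat_perm])

lemma compat_inj: "p i = p j \<longleftrightarrow> i = j"
  using compat_invol[of i] compat_invol[of j] by metis

text \<open>Equal letters at both ends force equal letters in between. A descent would demand a
  strict ascent of \<open>w\<close>, so \<open>p\<close> has no descent on such a block.\<close>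

lemma compat_block_mono:
  assumes "1 \<le> i" "i < j" "j \<le> 2 * n" "w i = w j"
  shows "p i < p j"
proof -
  have "p i < p j \<and> w i = w j" if "Suc i \<le> j" "j \<le> 2 * n" "w i = w j" for j
    using that
  proof (induction j rule: dec_induct)
    case base
    then have "i \<notin> descents n p"
      using compat_word assms(1) by (auto simp: step_words_def)
    then have "p i \<le> p (Suc i)" using base assms(1) by (auto simp: descents_def)
    then show ?case using compat_inj[of i "Suc i"] base by auto
  next
    case (step j)
    have "w i \<le> w j" "w j \<le> w (Suc j)"
      using step_words_mono[OF compat_word, of i j] step_words_mono[OF compat_word, of j "Suc j"]
        assms(1) step by auto
    then have wj: "w i = w j" "w j = w (Suc j)" using step by auto
    then have "j \<notin> descents n p"
      using compat_word assms(1) step by (auto simp: step_words_def)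
    then have "p j \<le> p (Suc j)" using step assms(1) by (auto simp: descents_def)
    moreover have "p j \<noteq> p (Suc j)" using compat_inj[of j "Suc j"] by simp
    ultimately show ?case using step wj by auto
  qed
  then show ?thesis using assms by auto
qed

text \<open>If \<open>i\<close> and \<open>p i\<close> lay in one block, then \<open>p\<close>,
  increasing there, could not exchange them.\<close>

lemma compat_no_loop: "i \<in> {1..2 * n} \<Longrightarrow> w i \<noteq> w (p i)"
proof
  assume i: "i \<in> {1..2 * n}" and eq: "w i = w (p i)"
  have "p i \<in> {1..2 * n}" "p i \<noteq> i" using compat_in compat_fixfree i by auto
  then show False
    using compat_block_mono[of i "p i"] compat_block_mono[of "p i" i] i eq
    by (cases "i < p i") (auto simp: compat_invol)
qed

lemma bij_betw_compat: "bij_betw p {i \<in> {1..2 * n}. Q i} {i \<in> {1..2 * n}. Q (p i)}"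
proof (rule bij_betw_byWitness[where f' = p])
  have "p i \<in> {i \<in> {1..2 * n}. Q (p i)}" if "i \<in> {1..2 * n}" "Q i" for i
    using compat_in[OF that(1)] that(2) by (simp add: compat_invol)
  then show "p ` {i \<in> {1..2 * n}. Q i} \<subseteq> {i \<in> {1..2 * n}. Q (p i)}" by blast
  have "p i \<in> {i \<in> {1..2 * n}. Q i}" if "i \<in> {1..2 * n}" "Q (p i)" for i
    using compat_in[OF that(1)] that(2) by simp
  then show "p ` {i \<in> {1..2 * n}. Q (p i)} \<subseteq> {i \<in> {1..2 * n}. Q i}" by blast
qed (simp_all add: compat_invol)

text \<open>\<open>p\<close> exchanges the positions whose letter is smaller than the partner's with
  those where it is larger, and without loops these two halves exhaust the \<open>2 * n\<close>
  positions.\<close>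

lemma size_edge_mset: "size (edge_mset n (p, w)) = n"
proof -
  let ?A = "{i \<in> {1..2 * n}. w i < w (p i)}" and ?B = "{i \<in> {1..2 * n}. w (p i) < w i}"
  have "card ?A = card ?B"
    using bij_betw_same_card[OF bij_betw_compat[of "\<lambda>i. w i < w (p i)"]] by (simp add: compat_invol)
  moreover have "{1..2 * n} = ?A \<union> ?B"
    using compat_no_loop by (fastforce simp del: atLeastAtMost_iff simp: neq_iff)
  then have "card {1..2 * n} = card (?A \<union> ?B)"
    by (rule arg_cong)
  moreover have "card (?A \<union> ?B) = card ?A + card ?B"
    by (rule card_Un_disjoint) auto
  ultimately show ?thesis by (simp add: edge_mset_def)
qed

lemma set_edge_mset: "set_mset (edge_mset n (p, w)) \<subseteq> {(a, b). a < b \<and> b \<le> r}"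
proof -
  have "w (p i) \<le> r" if "i \<in> {1..2 * n}" for i
    using compat_word compat_in[OF that] by (auto simp: step_words_def PiE_def Pi_def)
  then show ?thesis by (auto simp: edge_mset_def)
qed

lemma count_edge_mset:
  "count (edge_mset n (p, w)) (min a b, max a b) = card {i \<in> {1..2 * n}. w i = a \<and> w (p i) = b}"
proof -
  have *: "count (edge_mset n (p, w)) (a, b) = card {i \<in> {1..2 * n}. w i = a \<and> w (p i) = b}"
    if "a < b" for a b
  proof -
    have "count (edge_mset n (p, w)) (a, b) =
        (\<Sum>i\<in>{i \<in> {1..2 * n}. w i = a \<and> w (p i) = b}. 1)"
      unfolding edge_mset_def prod.case count_image_mset'
      by (intro sum.cong) (use that in auto)
    then show ?thesis by simp
  qed
  consider "a < b" | "b < a" | "a = b" by linarith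
  then show ?thesis
  proof cases
    case 1
    then show ?thesis using *[of a b] by simp
  next
    case 2
    then show ?thesis
      using *[of b a] bij_betw_same_card[OF bij_betw_compat[of "\<lambda>i. w i = a \<and> w (p i) = b"]]
      by (simp add: compat_invol conj_commute)
  next
    case 3
    then have "(a, b) \<notin># edge_mset n (p, w)" using set_edge_mset by auto
    moreover have "{i \<in> {1..2 * n}. w i = a \<and> w (p i) = b} = {}"
      using compat_no_loop 3 by fastforce
    ultimately show ?thesis using 3 by (metis card.empty max.idem min.idem not_in_iff)
  qed
qed

text \<open>The three components in turn: \<open>w\<close> is weakly increasing; within a block
  \<open>p\<close> increases, so \<open>w \<circ> p\<close> increases weakly; remaining ties are
  broken by the number of earlier occurrences.\<close>

lemma label_strict_mono:
  assumes "1 \<le> i" "i < j" "j \<le> 2 * n"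
  shows "(label p w i, label p w j) \<in> lex3"
proof -
  have le: "w i \<le> w j"
    using step_words_mono[OF compat_word, of i j] assms by simp
  have le': "w (p i) \<le> w (p j)" if "w i = w j"
    using step_words_mono[OF compat_word, of "p i" "p j"] compat_block_mono[OF assms that]
      compat_in[of i] compat_in[of j] assms by auto
  have "card {k \<in> {1..<i}. w k = w i \<and> w (p k) = w (p i)}
      < card {k \<in> {1..<j}. w k = w j \<and> w (p k) = w (p j)}"
    if "w i = w j" "w (p i) = w (p j)"
  proof (rule psubset_card_mono)
    have "i \<in> {k \<in> {1..<j}. w k = w j \<and> w (p k) = w (p j)}" using assms that by auto
    then show "{k \<in> {1..<i}. w k = w i \<and> w (p k) = w (p i)}
      \<subset> {k \<in> {1..<j}. w k = w j \<and> w (p k) = w (p j)}"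
      using assms that by auto
  qed simp
  then show ?thesis using le le' by (fastforce simp: label_def)
qed

text \<open>An occurrence number is below the multiplicity of its edge, so labels are half-edges.
  They are distinct by monotonicity, and there are only \<open>2 * n\<close> half-edges.\<close>

lemma bij_betw_label: "bij_betw (label p w) {1..2 * n} (half_edges (edge_mset n (p, w)))"
proof -
  let ?E = "half_edges (edge_mset n (p, w))"
  have inj: "inj_on (label p w) {1..2 * n}"
  proof (rule linorder_inj_onI')
    fix i j :: nat assume "i \<in> {1..2 * n}" "j \<in> {1..2 * n}" "i < j"
    then show "label p w i \<noteq> label p w j"
      using label_strict_mono[of i j] lex3_irrefl[of "label p w i"] by auto
  qed
  have "label p w i \<in> ?E" if "i \<in> {1..2 * n}" for i
  proof -
    have "i \<in> {j \<in> {1..2*n}. w j = w i \<and> w (p j) = w (p i)}" using that by simp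
    then have "card {j \<in> {1..<i}. w j = w i \<and> w (p j) = w (p i)}
        < card {j \<in> {1..2*n}. w j = w i \<and> w (p j) = w (p i)}"
      by (intro psubset_card_mono) (use that in auto)
    then show ?thesis by (simp add: label_def half_edges_def count_edge_mset)
  qed
  then have sub: "label p w ` {1..2 * n} \<subseteq> ?E" by auto
  have "set_mset (edge_mset n (p, w)) \<subseteq> {(a, b). a < b}" using set_edge_mset by auto
  then have "finite ?E" "card ?E = card {1..2 * n}"
    using finite_half_edges card_half_edges size_edge_mset by auto
  then have "label p w ` {1..2 * n} = ?E"
    by (metis card_image[OF inj] card_subset_eq sub)
  then show ?thesis using inj by (simp add: bij_betw_def)
qed

lemma lex_pos_label: "i \<in> {1..2 * n} \<Longrightarrow> lex_pos (half_edges (edge_mset n (p, w))) (label p w i) = i"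
  using bij_betw_label label_strict_mono by (rule lex_pos_bij_mono)

text \<open>Within a block of equal letters \<open>p\<close> increases, so it carries the earlier
  parallel positions of \<open>i\<close> to the earlier parallel positions of \<open>p i\<close>.
  The occurrence numbers therefore agree.\<close>

lemma label_twin:
  assumes i: "i \<in> {1..2 * n}"
  shows "label p w (p i) = twin (label p w i)"
proof -
  have "bij_betw p {j \<in> {1..<i}. w j = w i \<and> w (p j) = w (p i)}
      {j \<in> {1..<p i}. w j = w (p i) \<and> w (p j) = w (p (p i))}"
  proof (rule bij_betw_byWitness[where f' = p])
    have *: "p j \<in> {1..<p i}" if "j \<in> {1..<i}" "w j = w i" "i \<in> {1..2 * n}" for i j
      using compat_block_mono[of j i] compat_in[of j] that by auto
    show "p ` {j \<in> {1..<i}. w j = w i \<and> w (p j) = w (p i)}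
      \<subseteq> {j \<in> {1..<p i}. w j = w (p i) \<and> w (p j) = w (p (p i))}"
      using *[OF _ _ i] by (auto simp: compat_invol simp del: atLeastLessThan_iff)
    show "p ` {j \<in> {1..<p i}. w j = w (p i) \<and> w (p j) = w (p (p i))}
      \<subseteq> {j \<in> {1..<i}. w j = w i \<and> w (p j) = w (p i)}"
      using *[OF _ _ compat_in[OF i]] by (auto simp: compat_invol simp del: atLeastLessThan_iff)
  qed (auto simp: compat_invol)
  from bij_betw_same_card[OF this] show ?thesis
    by (simp add: label_def compat_invol)
qed

end

section \<open>The pair and the multigraph determine each other\<close>

lemma inj_on_edge_mset: "inj_on (edge_mset n) (compatible n r)"
proof (rule inj_onI, clarify)
  fix p w p' w' assume c: "(p, w) \<in> compatible n r" and c': "(p', w') \<in> compatible n r"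
    and eq: "edge_mset n (p, w) = edge_mset n (p', w')"
  let ?E = "half_edges (edge_mset n (p, w))"
  have "set_mset (edge_mset n (p, w)) \<subseteq> {(a, b). a < b}" using set_edge_mset[OF c] by auto
  then have "inj_on (lex_pos ?E) ?E"
    using bij_betw_lex_pos finite_half_edges by (auto simp: bij_betw_def)
  moreover have "label p w i \<in> ?E" "label p' w' i \<in> ?E" if "i \<in> {1..2 * n}" for i
    using bij_betw_label[OF c] bij_betw_label[OF c'] that eq bij_betwE by metis+
  \<comment> \<open>Both labels of \<open>i\<close> are the half-edge of rank
    \<open>i\<close>.\<close>
  ultimately have lab: "label p w i = label p' w' i" if "i \<in> {1..2 * n}" for i
    using that lex_pos_label[OF c that] lex_pos_label[OF c' that] eq by (metis inj_onD)
  have "w i = w' i" for i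
  proof (cases "i \<in> {1..2 * n}")
    case True
    then show ?thesis using lab by (simp add: label_def)
  next
    case False
    then show ?thesis using compat_word[OF c] compat_word[OF c']
      by (auto simp: step_words_def PiE_def extensional_def)
  qed
  moreover have "p i = p' i" for i
  proof (cases "i \<in> {1..2 * n}")
    case True
    \<comment> \<open>Both positions carry the twin of the half-edge of rank
      \<open>i\<close>.\<close>
    have "label p w (p i) = label p w (p' i)"
      using label_twin[OF c True] label_twin[OF c' True] lab[OF True] lab[OF compat_in[OF c' True]] by simp
    then show ?thesis
      by (rule inj_onD[OF bij_betw_imp_inj_on[OF bij_betw_label[OF c]]
            _ compat_in[OF c True] compat_in[OF c' True]])
  next
    case False
    then show ?thesis using compat_perm[OF c] compat_perm[OF c'] by (metis permutes_not_in)
  qed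
  ultimately show "p = p' \<and> w = w'" by (simp add: fun_eq_iff)
qed

lemma edge_mset_surj:
  assumes M: "set_mset M \<subseteq> {(a, b). a < b \<and> b \<le> r}" "size M = n"
  shows "M \<in> edge_mset n ` compatible n r"
proof -
  let ?E = "half_edges M"
  have M': "set_mset M \<subseteq> {(a, b). a < b}" using M by auto
  have fin: "finite ?E" and cE: "card ?E = 2 * n"
    using finite_half_edges[OF M'] card_half_edges[OF M'] M(2) by auto
  have bp: "bij_betw (lex_pos ?E) ?E {1..2 * n}" using bij_betw_lex_pos[OF fin] cE by simp
  define e where "e = inv_into ?E (lex_pos ?E)"
  have be: "bij_betw e {1..2 * n} ?E" unfolding e_def using bp by (rule bij_betw_inv_into)
  have eE: "e i \<in> ?E" and pe: "lex_pos ?E (e i) = i" if "i \<in> {1..2 * n}" for i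
    using that be bp by (auto simp: bij_betw_apply e_def bij_betw_inv_into_right simp del: atLeastAtMost_iff)
  have ep: "e (lex_pos ?E x) = x" and pE: "lex_pos ?E x \<in> {1..2 * n}" if "x \<in> ?E" for x
    using that bp by (auto simp: bij_betw_apply e_def bij_betw_inv_into_left simp del: atLeastAtMost_iff)
  have mono: "(e i, e j) \<in> lex3" if "i \<in> {1..2 * n}" "j \<in> {1..2 * n}" "i < j" for i j
    using lex_pos_less_iff[OF fin eE eE] that pe by metis
  define p where "p = (\<lambda>i. if i \<in> {1..2 * n} then lex_pos ?E (twin (e i)) else i)"
  define w where "w = (\<lambda>i\<in>{1..2 * n}. fst (e i))"
  have p_in: "p i \<in> {1..2 * n}" if "i \<in> {1..2 * n}" for i
    using that pE twin_half_edges eE by (simp add: p_def del: atLeastAtMost_iff)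
  have ep_twin: "e (p i) = twin (e i)" if "i \<in> {1..2 * n}" for i
    using that ep twin_half_edges eE by (simp add: p_def del: atLeastAtMost_iff)
  have pp: "p (p i) = i" for i
  proof (cases "i \<in> {1..2 * n}")
    case True
    have "p (p i) = lex_pos ?E (twin (e (p i)))" using p_in[OF True] by (simp add: p_def)
    then show ?thesis using pe[OF True] by (simp add: ep_twin[OF True])
  next
    case False
    then show ?thesis by (auto simp: p_def)
  qed
  have ne: "a \<noteq> b" if "(a, b, k) \<in> ?E" for a b k
    using that M' by (auto simp: half_edges_def simp flip: not_in_iff)
       (metis (no_types, lifting) case_prodD gr_implies_not0 less_irrefl mem_Collect_eq not_in_iff subsetD)
  have mat: "p \<in> matchings n"
  proof -
    have "p permutes {1..2 * n}"
      unfolding permutes_def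
      using pp by (metis p_def)
    moreover have "p i \<noteq> i" if "i \<in> {1..2 * n}" for i
      using ep_twin[OF that] eE[OF that] ne by (cases "e i") auto
    ultimately show ?thesis using pp by (auto simp: matchings_def fun_eq_iff)
  qed
  have wle: "fst (e i) \<le> r" if "i \<in> {1..2 * n}" for i
  proof -
    obtain a b k where abk: "e i = (a, b, k)" by (cases "e i")
    then have "k < count M (min a b, max a b)" using eE[OF that] by (simp add: half_edges_def)
    then have "(min a b, max a b) \<in># M" by (metis gr_implies_not0 not_in_iff)
    with M show ?thesis by (auto simp: abk)
  qed
  have word: "w \<in> step_words (descents n p) (2 * n) r"
  proof -
    have "w \<in> {1..2 * n} \<rightarrow>\<^sub>E {..r}" using wle by (auto simp: w_def)
    moreover have "w i \<le> w (Suc i) \<and> (i \<in> descents n p \<longrightarrow> w i < w (Suc i))"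
      if i: "i \<in> {1..<2 * n}" for i
    proof -
      have ii: "i \<in> {1..2 * n}" "Suc i \<in> {1..2 * n}" using i by auto
      obtain a b k where abk: "e i = (a, b, k)" by (cases "e i")
      obtain a' b' k' where abk': "e (Suc i) = (a', b', k')" by (cases "e (Suc i)")
      have lt: "(e i, e (Suc i)) \<in> lex3" using mono[OF ii] by simp
      have "w i = a" "w (Suc i) = a'" using ii abk abk' by (auto simp: w_def)
      moreover have "a \<le> a'" using lt abk abk' by auto
      \<comment> \<open>With a common first component, swapping the ends of both half-edges
        preserves their lexicographic order. So a descent at \<open>i\<close> forces
        \<open>a < a'\<close>.\<close>
      moreover have "p i < p (Suc i)" if "a = a'"
      proof -
        have "(e (p i), e (p (Suc i))) \<in> lex3"
          using lt ii that abk abk' by (auto simp: ep_twin)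
        then show ?thesis
          using lex_pos_less_iff[OF fin eE[OF p_in[OF ii(1)]] eE[OF p_in[OF ii(2)]]]
            pe[OF p_in[OF ii(1)]] pe[OF p_in[OF ii(2)]] by simp
      qed
      ultimately show ?thesis by (cases "a = a'") (auto simp: descents_def)
    qed
    ultimately show ?thesis by (simp add: step_words_def)
  qed
  have c: "(p, w) \<in> compatible n r" using mat word by (simp add: compatible_def)
  \<comment> \<open>Positions with letter \<open>a\<close> and partner letter \<open>b\<close>
    correspond under \<open>e\<close> to the half-edges \<open>(a, b, k)\<close>, one per copy of
    the edge.\<close>
  have *: "count (edge_mset n (p, w)) (min a b, max a b) = count M (min a b, max a b)" for a b
  proof -
    have "e ` {i \<in> {1..2 * n}. w i = a \<and> w (p i) = b} = {x \<in> ?E. fst x = a \<and> fst (twin x) = b}"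
    proof -
      have "w i = fst (e i) \<and> w (p i) = fst (twin (e i))" if "i \<in> {1..2 * n}" for i
        using that p_in[OF that] ep_twin[OF that] by (simp add: w_def del: atLeastAtMost_iff)
      then have "e ` {i \<in> {1..2 * n}. w i = a \<and> w (p i) = b}
          = e ` {i \<in> {1..2 * n}. fst (e i) = a \<and> fst (twin (e i)) = b}" by auto
      also have "\<dots> = {x \<in> e ` {1..2 * n}. fst x = a \<and> fst (twin x) = b}" by auto
      finally show ?thesis using be by (simp add: bij_betw_def)
    qed
    also have "\<dots> = (\<lambda>k. (a, b, k)) ` {..<count M (min a b, max a b)}"
      by (auto simp: half_edges_def)
    finally have im: "e ` {i \<in> {1..2 * n}. w i = a \<and> w (p i) = b} = \<dots>" .
    have "inj_on e {i \<in> {1..2 * n}. w i = a \<and> w (p i) = b}"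
      by (rule inj_on_subset[OF bij_betw_imp_inj_on[OF be]]) auto
    then have "card {i \<in> {1..2 * n}. w i = a \<and> w (p i) = b}
        = card (e ` {i \<in> {1..2 * n}. w i = a \<and> w (p i) = b})"
      by (simp add: card_image)
    also have "\<dots> = count M (min a b, max a b)"
      unfolding im by (subst card_image) (auto simp: inj_on_def)
    finally show ?thesis by (simp only: count_edge_mset[OF c])
  qed
  have "edge_mset n (p, w) = M"
  proof (rule multiset_eqI, clarify)
    fix a b
    show "count (edge_mset n (p, w)) (a, b) = count M (a, b)"
    proof (cases "a < b")
      case True
      then show ?thesis using *[of a b] by simp
    next
      case False
      then have "(a, b) \<notin># edge_mset n (p, w)" "(a, b) \<notin># M"
        using set_edge_mset[OF c] M by auto
      then show ?thesis by (simp add: not_in_iff)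
    qed
  qed
  then show ?thesis using c by force
qed

text \<open>Compatible pairs counted twice: by \<open>card_step_words\<close> for each matching, and
  as multisets of \<open>n\<close> edges drawn from the \<open>r * (r + 1) div 2\<close> pairs
  \<open>a < b\<close> of letters up to \<open>r\<close>.\<close>

lemma sum_matchings_choose:
  "(\<Sum>p\<in>matchings n. (r + 2 * n - num_descents (2 * n) p) choose (2 * n))
     = (r * (r + 1) div 2 + n - 1) choose n"
proof -
  have "bij_betw (edge_mset n) (compatible n r) (multisets_of_size {(a, b). a < b \<and> b \<le> r} n)"
    unfolding bij_betw_def
  proof (intro conjI inj_on_edge_mset set_eqI iffI)
    fix M assume "M \<in> edge_mset n ` compatible n r"
    then show "M \<in> multisets_of_size {(a, b). a < b \<and> b \<le> r} n"
      using set_edge_mset size_edge_mset by (fastforce simp: multisets_of_size_def)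
  next
    fix M assume "M \<in> multisets_of_size {(a, b). a < b \<and> b \<le> r} n"
    then show "M \<in> edge_mset n ` compatible n r"
      using edge_mset_surj by (auto simp: multisets_of_size_def)
  qed
  moreover have A: "{(a, b). a < b \<and> b \<le> r} = (\<lambda>(b, a). (a, b)) ` (SIGMA b:{..r}. {..<b})"
    by force
  have "finite {(a, b). a < b \<and> b \<le> r}" unfolding A by auto
  moreover have "card {(a, b). a < b \<and> b \<le> r} = r * (r + 1) div 2"
    unfolding A by (subst card_image) (auto simp: inj_on_def gauss_sum_nat atMost_atLeast0)
  ultimately have "card (compatible n r) = (r * (r + 1) div 2 + n - 1) choose n"
    by (simp add: bij_betw_same_card card_multisets_of_size)
  moreover have "descents n p \<inter> {1..<2 * n} = descents n p" for p
    by (auto simp: descents_def)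
  then have "card (descents n p \<inter> {1..<2 * n}) = num_descents (2 * n) p" for p
    by (simp add: descents_def num_descents_def)
  ultimately show ?thesis
    by (simp add: compatible_def finite_matchings finite_step_words card_step_words)
qed

subsection \<open>Generating functions\<close>

text \<open>Newton's binomial series for the exponent \<open>- (N + 1)\<close> at
  \<open>- t\<close>; the two signs cancel.\<close>

lemma choose_sums:
  fixes t :: complex
  assumes "norm t < 1"
  shows "(\<lambda>r. of_nat ((r + N) choose N) * t ^ r) sums (1 / (1 - t) ^ Suc N)"
proof -
  have t1: "1 - t \<noteq> 0" using assms by auto
  have coeff: "(- of_nat (Suc N) gchoose r) * (- t) ^ r = of_nat ((r + N) choose N) * t ^ r" for r
  proof -
    have "(- of_nat (Suc N) :: complex) gchoose r = (- 1) ^ r * (of_nat (N + r) gchoose r)"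
      by (subst gbinomial_minus) (simp add: algebra_simps)
    also have "(of_nat (N + r) :: complex) gchoose r = of_nat ((N + r) choose r)"
      by (simp only: binomial_gbinomial)
    also have "(N + r) choose r = (r + N) choose N"
      using binomial_symmetric[of r "N + r"] by (simp add: add.commute)
    finally have e: "(- of_nat (Suc N) :: complex) gchoose r = (- 1) ^ r * of_nat ((r + N) choose N)" .
    have sgn: "(- 1) ^ r * (- t) ^ r = t ^ r" by (simp flip: power_mult_distrib)
    show ?thesis unfolding e sgn[symmetric] by (simp only: mult_ac)
  qed
  have "(\<lambda>r. (- of_nat (Suc N) gchoose r) * (- t) ^ r) sums (1 + - t) powr (- of_nat (Suc N))"
    using assms by (intro gen_binomial_complex) simp
  also have "(1 + - t) powr (- of_nat (Suc N)) = 1 / (1 - t) ^ Suc N"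
    using t1 by (simp add: powr_minus_divide powr_nat' del: of_nat_Suc power_Suc)
  finally show ?thesis by (simp only: coeff)
qed

text \<open>The preceding series moved by \<open>d\<close>: terms with \<open>r < d\<close> vanish
  because their upper index is below \<open>N\<close>.\<close>

lemma shifted_choose_sums:
  fixes t :: complex
  assumes "norm t < 1" "d \<le> N"
  shows "(\<lambda>r. of_nat ((r + N - d) choose N) * t ^ r) sums (t ^ d / (1 - t) ^ Suc N)"
proof -
  have "(\<lambda>r. t ^ d * (of_nat ((r + N) choose N) * t ^ r)) sums (t ^ d * (1 / (1 - t) ^ Suc N))"
    by (rule sums_mult[OF choose_sums[OF assms(1)]])
  then have "(\<lambda>r. of_nat ((r + d + N - d) choose N) * t ^ (r + d)) sums (t ^ d / (1 - t) ^ Suc N)"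
    by (simp add: power_add mult_ac)
  moreover have "(\<Sum>r<d. of_nat ((r + N - d) choose N) * t ^ r) = 0"
    using assms(2) by (intro sum.neutral) (auto intro!: binomial_eq_0)
  ultimately show ?thesis
    using sums_iff_shift[of "\<lambda>r. of_nat ((r + N - d) choose N) * t ^ r" d] by simp
qed

text \<open>\<open>2 ^ n\<close> times the rising factorial of length \<open>n\<close> of
  \<open>x * (x + 1) / 2\<close>. At natural \<open>x\<close> that rising factorial, divided by
  \<open>fact n\<close>, counts the multisets of \<open>n\<close> edges.\<close>

definition rising_poly :: "nat \<Rightarrow> real poly" where
  "rising_poly n = (\<Prod>k<n. [:2 * real k, 1, 1:])"

lemma degree_rising_poly: "degree (rising_poly n) = 2 * n"
  unfolding rising_poly_def by (subst degree_prod_sum_eq) auto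

lemma lead_coeff_rising_poly: "coeff (rising_poly n) (2 * n) = 1"
  using lead_coeff_prod[of "\<lambda>k. [:2 * real k, 1, 1:]" "{..<n}"]
  by (simp add: degree_rising_poly flip: rising_poly_def)

lemma coeff_rising_poly_nonneg: "coeff (rising_poly n) i \<ge> 0"
proof (induction n arbitrary: i)
  case (Suc n)
  have "coeff [:2 * real n, 1, 1:] j \<ge> 0" for j
    by (auto simp: coeff_pCons split: nat.split)
  then show ?case
    unfolding rising_poly_def lessThan_Suc
    by (simp add: coeff_mult Suc.IH flip: rising_poly_def del: mult_pCons_left)
       (intro sum_nonneg mult_nonneg_nonneg Suc.IH)
qed (auto simp: rising_poly_def)

lemma poly_rising_poly: "poly (rising_poly n) x = (\<Prod>k<n. x\<^sup>2 + x + 2 * real k)"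
  by (simp add: rising_poly_def poly_prod algebra_simps power2_eq_square)

lemma poly_rising_poly_sum: "poly (rising_poly n) x = (\<Sum>i\<le>2 * n. coeff (rising_poly n) i * x ^ i)"
  by (simp add: poly_altdef degree_rising_poly)

lemma choose_eq_rising_poly:
  "real ((r * (r + 1) div 2 + n - 1) choose n) * (2 ^ n * fact n) = poly (rising_poly n) (real r)"
proof (cases n)
  case 0
  then show ?thesis by (simp add: rising_poly_def)
next
  case (Suc n')
  define m where "m = r * (r + 1) div 2"
  have m: "2 * real m = real r * (real r + 1)"
  proof -
    have "2 * m = r * (r + 1)" by (simp add: m_def)
    then have "real (2 * m) = real (r * (r + 1))" by (rule arg_cong)
    then show ?thesis by (simp add: algebra_simps)
  qed
  have "real ((m + n - 1) choose n) * fact n = (real (m + n - 1) gchoose n) * fact n"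
    by (simp only: binomial_gbinomial)
  also have "\<dots> = pochhammer (real m) n"
    by (simp add: gbinomial_pochhammer' Suc)
  finally have "real ((m + n - 1) choose n) * (2 ^ n * fact n) = 2 ^ n * (\<Prod>k<n. real m + real k)"
    by (simp add: pochhammer_prod atLeast0LessThan)
  also have "\<dots> = (\<Prod>k<n. 2 * (real m + real k))"
    by (simp only: prod.distrib prod_constant card_lessThan)
  also have "\<dots> = (\<Prod>k<n. (real r)\<^sup>2 + real r + 2 * real k)"
    using m by (intro prod.cong) (auto simp: algebra_simps power2_eq_square)
  finally show ?thesis by (simp add: poly_rising_poly m_def)
qed

subsection \<open>Eulerian polynomials near 1\<close>

text \<open>Termwise differentiation followed by multiplication by \<open>t\<close> raises the
  exponent of \<open>r\<close> by one and keeps convergence inside the unit disc.\<close>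

lemma summable_pow_pow:
  fixes t :: complex
  assumes "norm t < 1"
  shows "summable (\<lambda>r. of_nat r ^ j * t ^ r)"
  using assms
proof (induction j arbitrary: t)
  case 0
  then show ?case by (simp add: summable_geometric)
next
  case (Suc j)
  have "summable (\<lambda>r. diffs (\<lambda>r. of_nat r ^ j) r * t ^ r)"
    by (rule termdiff_converges[where K = 1]) (use Suc in auto)
  then have "summable (\<lambda>r. t * (of_nat (Suc r) ^ Suc j * t ^ r))"
    by (intro summable_mult) (simp add: diffs_def del: of_nat_Suc)
  then have "summable (\<lambda>r. of_nat (Suc r) ^ Suc j * t ^ Suc r)"
    by (simp add: mult_ac del: of_nat_Suc)
  then show ?case by (subst (asm) summable_Suc_iff)
qed

definition pow_series :: "complex \<Rightarrow> nat \<Rightarrow> complex" where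
  "pow_series t j = (\<Sum>r. of_nat r ^ j * t ^ r)"

lemma pow_series_sums: "norm t < 1 \<Longrightarrow> (\<lambda>r. of_nat r ^ j * t ^ r) sums pow_series t j"
  unfolding pow_series_def by (intro summable_sums summable_pow_pow)

text \<open>Equals \<open>(1 - t) ^ Suc m / fact m * (\<Sum>r. (r + x) ^ m * t ^ r)\<close>, expanded by the binomial
  theorem so that it is visibly a polynomial in \<open>x\<close>. For \<open>x \<in> {0..1}\<close> it is the sum over
  \<open>k\<close> of \<open>t ^ k\<close> times the density at \<open>k + x\<close> of a sum of \<open>Suc m\<close> independent uniform
  variables on \<open>{0..1}\<close>; at \<open>x = 0\<close> it is the normalized Eulerian polynomial.\<close>

definition shifted_eulerian :: "complex \<Rightarrow> nat \<Rightarrow> complex \<Rightarrow> complex" where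
  "shifted_eulerian t m x =
     (1 - t) ^ Suc m / fact m * (\<Sum>j\<le>m. of_nat (m choose j) * x ^ (m - j) * pow_series t j)"

lemma pow_series_0: "norm t < 1 \<Longrightarrow> pow_series t 0 = 1 / (1 - t)"
  using sums_unique2[OF pow_series_sums[of t 0]] geometric_sums[of t] by simp

lemma shifted_eulerian_0: "norm t < 1 \<Longrightarrow> shifted_eulerian t 0 x = 1"
  by (auto simp: shifted_eulerian_def pow_series_0)

lemma shifted_eulerian_at_0: "shifted_eulerian t m 0 = (1 - t) ^ Suc m / fact m * pow_series t m"
proof -
  have "(\<Sum>j\<le>m. of_nat (m choose j) * 0 ^ (m - j) * pow_series t j)
      = (\<Sum>j\<in>{m}. of_nat (m choose j) * 0 ^ (m - j) * pow_series t j)"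
    by (rule sum.mono_neutral_right) auto
  then show ?thesis by (simp add: shifted_eulerian_def)
qed

text \<open>Differentiating \<open>(r + x) ^ (m + 1)\<close> brings down the factor
  \<open>m + 1\<close>, which turns \<open>fact (m + 1)\<close> into \<open>fact m\<close>; one
  factor \<open>1 - t\<close> of the normalization is left over.\<close>

lemma shifted_eulerian_deriv:
  "(shifted_eulerian t (Suc m) has_field_derivative (1 - t) * shifted_eulerian t m x) (at x within S)"
proof -
  have eq: "of_nat (Suc m choose j) * (of_nat (Suc m - j) * x ^ (Suc m - j - 1)) * s
      = of_nat (Suc m) * (of_nat (m choose j) * x ^ (m - j) * s)" for j and s :: complex
  proof -
    have "of_nat (Suc m - j) * of_nat (Suc m choose j) = (of_nat (Suc m) * of_nat (m choose j) :: complex)"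
      by (simp only: of_nat_mult[symmetric] binomial_absorb_comp diff_Suc_1)
    then have "of_nat (Suc m - j) * of_nat (Suc m choose j) * (x ^ (m - j) * s)
        = of_nat (Suc m) * of_nat (m choose j) * (x ^ (m - j) * s)" by (simp only:)
    moreover have "Suc m - j - 1 = m - j" by simp
    ultimately show ?thesis by (simp only: mult_ac)
  qed
  have pw: "((\<lambda>x. x ^ k) has_field_derivative of_nat k * x ^ (k - 1)) (at x within S)" for k
    by (auto intro!: derivative_eq_intros)
  have "((\<lambda>x. \<Sum>j\<le>Suc m. of_nat (Suc m choose j) * x ^ (Suc m - j) * pow_series t j) has_field_derivative
      (\<Sum>j\<le>Suc m. of_nat (Suc m choose j) * (of_nat (Suc m - j) * x ^ (Suc m - j - 1)) * pow_series t j))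
      (at x within S)"
    by (intro DERIV_sum DERIV_cmult DERIV_cmult_right pw)
  also have "(\<Sum>j\<le>Suc m. of_nat (Suc m choose j) * (of_nat (Suc m - j) * x ^ (Suc m - j - 1)) * pow_series t j)
      = of_nat (Suc m) * (\<Sum>j\<le>Suc m. of_nat (m choose j) * x ^ (m - j) * pow_series t j)"
    by (simp only: eq sum_distrib_left)
  also have "(\<Sum>j\<le>Suc m. of_nat (m choose j) * x ^ (m - j) * pow_series t j)
      = (\<Sum>j\<le>m. of_nat (m choose j) * x ^ (m - j) * pow_series t j)"
    by (simp add: binomial_eq_0)
  finally have "((\<lambda>x. (1 - t) ^ Suc (Suc m) / fact (Suc m) * (\<Sum>j\<le>Suc m. of_nat (Suc m choose j) * x ^ (Suc m - j) * pow_series t j))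
      has_field_derivative (1 - t) ^ Suc (Suc m) / fact (Suc m) *
        (of_nat (Suc m) * (\<Sum>j\<le>m. of_nat (m choose j) * x ^ (m - j) * pow_series t j))) (at x within S)"
    by (rule DERIV_cmult)
  moreover have "a ^ Suc (Suc m) / fact (Suc m) * (of_nat (Suc m) * s) = a * (a ^ Suc m / fact m * s)"
    for a s :: complex
    by (simp add: field_simps del: of_nat_Suc)
  ultimately show ?thesis by (simp only: shifted_eulerian_def[abs_def])
qed

text \<open>Moving from \<open>x = 1\<close> to \<open>x = 0\<close> is the index shift from
  \<open>r + 1\<close> to \<open>r\<close>. The term at \<open>r = 0\<close> that the shift misses
  is 0 because the exponent \<open>Suc m\<close> is positive.\<close>

lemma shifted_eulerian_periodic:
  assumes "norm t < 1"
  shows "shifted_eulerian t (Suc m) 0 = t * shifted_eulerian t (Suc m) 1"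
proof -
  let ?M = "Suc m"
  let ?S = "\<Sum>j\<le>?M. of_nat (?M choose j) * pow_series t j"
  have "(\<Sum>j\<le>?M. of_nat (?M choose j) * (of_nat r ^ j * t ^ r)) = of_nat (Suc r) ^ ?M * t ^ r" for r
  proof -
    have "of_nat (Suc r) ^ ?M = (of_nat r + 1 :: complex) ^ ?M"
      by (simp only: of_nat_Suc add.commute)
    also have "\<dots> = (\<Sum>j\<le>?M. of_nat (?M choose j) * of_nat r ^ j)"
      by (simp only: binomial_ring power_one mult_1_right)
    finally show ?thesis by (simp only: sum_distrib_right mult.assoc)
  qed
  moreover have "(\<lambda>r. \<Sum>j\<le>?M. of_nat (?M choose j) * (of_nat r ^ j * t ^ r)) sums ?S"
    by (intro sums_sum sums_mult pow_series_sums assms)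
  ultimately have "(\<lambda>r. of_nat (Suc r) ^ ?M * t ^ r) sums ?S"
    by (simp only:)
  from sums_mult[OF this, of t]
  have "(\<lambda>r. t * (of_nat (Suc r) ^ ?M * t ^ r)) sums (t * ?S)" .
  moreover have "t * (a * t ^ r) = a * t ^ Suc r" for a r by simp
  ultimately have "(\<lambda>r. of_nat (Suc r) ^ ?M * t ^ Suc r) sums (t * ?S)"
    by (simp only:)
  then have "(\<lambda>r. of_nat r ^ ?M * t ^ r) sums (t * ?S)"
    by (subst (asm) sums_Suc_iff) simp
  then have "pow_series t ?M = t * ?S"
    using pow_series_sums[OF assms] by (rule sums_unique2[symmetric])
  then show ?thesis
    unfolding shifted_eulerian_at_0
    by (simp only: shifted_eulerian_def power_one mult_1_right mult.left_commute)
qed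

lemma shifted_eulerian_lipschitz:
  assumes B: "\<And>u. u \<in> {0..1} \<Longrightarrow> norm (shifted_eulerian t m (of_real u)) \<le> 1"
    and "a \<in> {0..1}" "b \<in> {0..1}"
  shows "norm (shifted_eulerian t (Suc m) (of_real a) - shifted_eulerian t (Suc m) (of_real b))
    \<le> norm (1 - t) * \<bar>a - b\<bar>"
proof -
  have "norm (shifted_eulerian t (Suc m) (of_real a) - shifted_eulerian t (Suc m) (of_real b))
      \<le> norm (1 - t) * norm (of_real a - of_real b :: complex)"
  proof (rule field_differentiable_bound)
    show "convex (of_real ` {0..1} :: complex set)"
      by (intro convex_linear_image) (auto intro: bounded_linear.linear bounded_linear_of_real)
    show "(shifted_eulerian t (Suc m) has_field_derivative (1 - t) * shifted_eulerian t m x)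
        (at x within of_real ` {0..1})" for x
      by (rule shifted_eulerian_deriv)
    show "norm ((1 - t) * shifted_eulerian t m x) \<le> norm (1 - t)" if "x \<in> of_real ` {0..1}" for x
      using B that by (auto simp: norm_mult intro!: mult_left_le)
  qed (use assms in auto)
  then show ?thesis by (simp flip: of_real_diff)
qed

text \<open>Writing \<open>h\<close> for order \<open>Suc m\<close>, the relation
  \<open>h 0 = t * h 1\<close> makes \<open>(1 - t) * h u\<close> a combination of the increments
  over \<open>{0..u}\<close> and \<open>{u..1}\<close>. Their Lipschitz bounds add up to
  \<open>norm (1 - t)\<close>, which cancels, so the bound 1 persists at every order.\<close>

lemma norm_shifted_eulerian_le_1:
  assumes t: "norm t < 1" and "u \<in> {0..1}"
  shows "norm (shifted_eulerian t m (of_real u)) \<le> 1"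
  using assms(2)
proof (induction m arbitrary: u)
  case 0
  then show ?case using t by (simp add: shifted_eulerian_0)
next
  case (Suc m)
  let ?h = "\<lambda>u. shifted_eulerian t (Suc m) (of_real u)"
  have t1: "norm (1 - t) > 0" using t by auto
  have "(1 - t) * ?h u = (?h u - ?h 0) + t * (?h 1 - ?h u)"
    using shifted_eulerian_periodic[OF t, of m] by (simp add: algebra_simps)
  then have "norm (1 - t) * norm (?h u) = norm ((?h u - ?h 0) + t * (?h 1 - ?h u))"
    by (metis norm_mult)
  also have "\<dots> \<le> norm (?h u - ?h 0) + norm t * norm (?h 1 - ?h u)"
    by (metis norm_mult norm_triangle_ineq)
  also have "\<dots> \<le> norm (1 - t) * u + 1 * (norm (1 - t) * (1 - u))"
    using shifted_eulerian_lipschitz[OF Suc.IH, of u 0] shifted_eulerian_lipschitz[OF Suc.IH, of 1 u]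
      Suc.prems t by (intro add_mono mult_mono) auto
  also have "\<dots> = norm (1 - t) * 1" by (simp add: algebra_simps)
  finally show ?case using t1 by (simp only: mult_le_cancel_left_pos)
qed

text \<open>Mean value inequality on the right half-plane, where the derivative of
  \<open>exp (- w)\<close> has norm at most 1.\<close>

lemma norm_one_minus_exp_le:
  fixes w :: complex
  assumes "Re w \<ge> 0"
  shows "norm (1 - exp (- w)) \<le> norm w"
proof -
  have "norm (exp (- 0) - exp (- w)) \<le> 1 * norm (0 - w)"
  proof (rule field_differentiable_bound)
    show "convex {w. Re w \<ge> 0}" by (rule convex_halfspace_Re_ge)
    show "((\<lambda>w. exp (- w)) has_field_derivative - exp (- z)) (at z within {w. Re w \<ge> 0})" for z :: complex
      by (auto intro!: derivative_eq_intros)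
  qed (use assms in auto)
  then show ?thesis by simp
qed

text \<open>The power on the left is the integral over \<open>x \<in> {0..1}\<close> of
  \<open>shifted_eulerian t m x * exp (- z * x)\<close>; the proof integrates by parts along \<open>m\<close>, the
  boundary terms cancelling by periodicity.\<close>

lemma shifted_eulerian_approx:
  assumes z: "Re z > 0" and t: "t = exp (- z)"
  shows "norm (((1 - t) / z) ^ Suc m - shifted_eulerian t m 0) \<le> norm (1 - t) + norm z"
proof -
  have nt: "norm t < 1" using z by (simp add: t)
  have z0: "z \<noteq> 0" using z by auto
  let ?h = "shifted_eulerian t"
  have "\<exists>F. (\<forall>x. (F has_field_derivative ?h m x * exp (- z * x)) (at x)) \<and> F 1 - F 0 = ((1 - t) / z) ^ Suc m"
  proof (induction m)
    case 0
    show ?case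
      using z0 nt by (intro exI[of _ "\<lambda>x. - exp (- z * x) / z"])
        (auto intro!: derivative_eq_intros simp: shifted_eulerian_0 t field_simps)
  next
    case (Suc m)
    then obtain F where F: "\<And>x. (F has_field_derivative ?h m x * exp (- z * x)) (at x)"
      "F 1 - F 0 = ((1 - t) / z) ^ Suc m" by blast
    let ?G = "\<lambda>x. ((1 - t) * F x - ?h (Suc m) x * exp (- z * x)) / z"
    have "(?G has_field_derivative ?h (Suc m) x * exp (- z * x)) (at x)" for x
      by (rule derivative_eq_intros F shifted_eulerian_deriv refl | use z0 in \<open>simp add: field_simps\<close>)+
    moreover have "?G 1 - ?G 0 = ((1 - t) / z) ^ Suc (Suc m)"
    proof -
      have "?G 1 - ?G 0 = ((1 - t) * (F 1 - F 0) + (?h (Suc m) 0 - t * ?h (Suc m) 1)) / z"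
        by (simp add: t diff_divide_distrib add_divide_distrib algebra_simps)
      also have "\<dots> = (1 - t) / z * (F 1 - F 0)"
        using shifted_eulerian_periodic[OF nt, of m] by simp
      finally show ?thesis by (simp add: F)
    qed
    ultimately show ?case by (intro exI[of _ ?G] conjI allI)
  qed
  then obtain F where F: "\<And>x. (F has_field_derivative ?h m x * exp (- z * x)) (at x)"
    "F 1 - F 0 = ((1 - t) / z) ^ Suc m" by blast
  have eq: "(F 1 - ?h m 0 * 1) - (F 0 - ?h m 0 * 0) = ((1 - t) / z) ^ Suc m - ?h m 0"
    unfolding F(2)[symmetric] by (simp only: mult_1_right mult_zero_right) (simp add: algebra_simps)
  \<comment> \<open>The mean value inequality on \<open>{0..1}\<close> for
    \<open>F x - ?h m 0 * x\<close>. Its derivative splits into the variation of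
    \<open>?h m\<close>, at most \<open>norm (1 - t)\<close>, and the effect of replacing
    \<open>exp (- z * x)\<close> by 1, at most \<open>norm z\<close>.\<close>
  have "norm ((F 1 - ?h m 0 * 1) - (F 0 - ?h m 0 * 0)) \<le> (norm (1 - t) + norm z) * norm (1 - 0 :: complex)"
  proof (rule field_differentiable_bound)
    show "convex (of_real ` {0..1} :: complex set)"
      by (intro convex_linear_image) (auto intro: bounded_linear.linear bounded_linear_of_real)
    show "((\<lambda>x. F x - ?h m 0 * x) has_field_derivative ?h m x * exp (- z * x) - ?h m 0)
        (at x within of_real ` {0..1})" for x
      by (rule has_field_derivative_at_within) (auto intro!: derivative_eq_intros F)
    show "norm (?h m x * exp (- z * x) - ?h m 0) \<le> norm (1 - t) + norm z" if x: "x \<in> of_real ` {0..1}" for x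
    proof -
      obtain u where u: "u \<in> {0..1}" "x = of_real u" using x by (elim imageE)
      have "norm (?h m x - ?h m 0) \<le> norm (1 - t) * 1"
      proof (cases m)
        case 0
        then show ?thesis using nt by (simp add: shifted_eulerian_0)
      next
        case (Suc m')
        have "norm (?h m x - ?h m 0) \<le> norm (1 - t) * \<bar>u - 0\<bar>"
          unfolding Suc u(2)
          using shifted_eulerian_lipschitz[OF norm_shifted_eulerian_le_1[OF nt], of u 0 m'] u by auto
        also have "\<dots> \<le> norm (1 - t) * 1" using u by (intro mult_left_mono) auto
        finally show ?thesis .
      qed
      moreover have "norm (?h m x * (1 - exp (- z * x))) \<le> 1 * (norm z * 1)"
      proof -
        have "norm (1 - exp (- (z * x))) \<le> norm (z * x)"
          using u z by (intro norm_one_minus_exp_le) auto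
        also have "\<dots> \<le> norm z * 1"
          unfolding norm_mult using u by (intro mult_left_mono) auto
        finally show ?thesis
          unfolding norm_mult using norm_shifted_eulerian_le_1[OF nt u(1), of m] u(2)
          by (intro mult_mono) auto
      qed
      moreover have "?h m x * exp (- z * x) - ?h m 0
          = (?h m x - ?h m 0) - ?h m x * (1 - exp (- z * x))" by (simp add: algebra_simps)
      ultimately show ?thesis
        by (smt (verit) norm_triangle_ineq4)
    qed
    show "(1 :: complex) \<in> of_real ` {0..1}" by (rule image_eqI[of _ _ 1]) auto
    show "(0 :: complex) \<in> of_real ` {0..1}" by (rule image_eqI[of _ _ 0]) auto
  qed
  then show ?thesis unfolding eq by (simp only: diff_zero norm_one mult_1_right)
qed

subsection \<open>The descent polynomial near 1\<close>

lemma power_div_fact_le_exp: "x \<ge> 0 \<Longrightarrow> x ^ j / fact j \<le> exp (x :: real)"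
  using sum_le_suminf[OF summable_exp[of x], of "{j}"]
  by (simp add: exp_def field_simps)

text \<open>For \<open>j = N - i > 0\<close>, \<open>N ^ j \<le> (N choose j) * j ^ j\<close>, and
  \<open>j ^ j / fact j\<close> is one term of the series of \<open>exp j\<close>. Expanding the
  binomial coefficient leaves the ratio.\<close>

lemma fact_ratio_le:
  assumes "i \<le> N" "N > 0"
  shows "fact i / fact N \<le> (exp 1 / real N) ^ (N - i)"
proof (cases "i = N")
  case False
  define j where "j = N - i"
  have j: "j > 0" "j \<le> N" "N - j = i" using False assms by (auto simp: j_def)
  have "(real N / real j) ^ j \<le> real (N choose j)"
    using j by (intro binomial_ge_n_over_k_pow_k)
  then have "real N ^ j \<le> real (N choose j) * real j ^ j"
    using j by (simp add: power_divide field_simps)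
  also have "real j ^ j \<le> exp 1 ^ j * fact j"
    using power_div_fact_le_exp[of "real j" j] by (simp add: field_simps flip: exp_of_nat_mult)
  finally have "real N ^ j \<le> real (N choose j) * (exp 1 ^ j * fact j)"
    by (simp add: mult_left_mono)
  then have "fact i * real N ^ j \<le> fact i * (real (N choose j) * (exp 1 ^ j * fact j))"
    by (intro mult_left_mono) auto
  also have "real (N choose j) = fact N / (fact j * fact i)"
    using binomial_fact[OF j(2), where ?'a = real] j(3) by simp
  finally have "fact i * real N ^ j \<le> fact N * exp 1 ^ j"
    by (simp add: field_simps)
  then show ?thesis
    using assms(2) by (simp add: power_divide field_simps flip: j_def)
qed simp

definition descent_poly :: "nat \<Rightarrow> complex \<Rightarrow> complex" where
  "descent_poly n t = (\<Sum>p\<in>matchings n. t ^ num_descents (2 * n) p)"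

lemma num_descents_le: "num_descents m p \<le> m"
  unfolding num_descents_def by (rule order_trans[OF card_mono[of "{1..m-1}"]]) auto

lemma descent_poly_sums:
  assumes "norm t < 1"
  shows "(\<lambda>r. of_real (poly (rising_poly n) (real r)) * t ^ r) sums
    (2 ^ n * fact n * descent_poly n t / (1 - t) ^ Suc (2 * n))"
proof -
  have "(\<lambda>r. \<Sum>p\<in>matchings n. of_nat ((r + 2 * n - num_descents (2 * n) p) choose (2 * n)) * t ^ r) sums
      (\<Sum>p\<in>matchings n. t ^ num_descents (2 * n) p / (1 - t) ^ Suc (2 * n))"
    by (intro sums_sum shifted_choose_sums assms num_descents_le)
  then have "(\<lambda>r. of_nat ((r * (r + 1) div 2 + n - 1) choose n) * t ^ r) sums
      (descent_poly n t / (1 - t) ^ Suc (2 * n))"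
    by (simp only: descent_poly_def sum_divide_distrib sum_matchings_choose
        flip: sum_distrib_right of_nat_sum)
  from sums_mult[OF this, of "2 ^ n * fact n"]
  have "(\<lambda>r. (2 ^ n * fact n) * (of_nat ((r * (r + 1) div 2 + n - 1) choose n) * t ^ r)) sums
      (2 ^ n * fact n * descent_poly n t / (1 - t) ^ Suc (2 * n))" by simp
  moreover have "(2 ^ n * fact n) * (of_nat ((r * (r + 1) div 2 + n - 1) choose n) * t ^ r)
      = of_real (poly (rising_poly n) (real r)) * t ^ r" for r
    unfolding choose_eq_rising_poly[symmetric] by simp
  ultimately show ?thesis by (simp only:)
qed

text \<open>Each power \<open>r ^ i\<close> sums to an Eulerian term with denominator
  \<open>(1 - t) ^ Suc i\<close>; clearing \<open>(1 - t) ^ Suc (2 * n)\<close> leaves one factor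
  \<open>1 - t\<close> for every degree missing from \<open>2 * n\<close>.\<close>

lemma descent_poly_expansion:
  assumes "norm t < 1"
  shows "2 ^ n * fact n * descent_poly n t =
    (\<Sum>i\<le>2 * n. of_real (coeff (rising_poly n) i * fact i) * (1 - t) ^ (2 * n - i) * shifted_eulerian t i 0)"
proof -
  have t1: "1 - t \<noteq> 0" using assms by auto
  have "(\<lambda>r. \<Sum>i\<le>2 * n. of_real (coeff (rising_poly n) i) * (of_nat r ^ i * t ^ r)) sums
      (\<Sum>i\<le>2 * n. of_real (coeff (rising_poly n) i) * pow_series t i)"
    by (intro sums_sum sums_mult pow_series_sums assms)
  moreover have "(\<Sum>i\<le>2 * n. of_real (coeff (rising_poly n) i) * (of_nat r ^ i * t ^ r))
      = of_real (poly (rising_poly n) (real r)) * t ^ r" for r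
    by (simp add: poly_rising_poly_sum sum_distrib_right mult.assoc)
  ultimately have "2 ^ n * fact n * descent_poly n t / (1 - t) ^ Suc (2 * n)
      = (\<Sum>i\<le>2 * n. of_real (coeff (rising_poly n) i) * pow_series t i)"
    using descent_poly_sums[OF assms, of n] sums_unique2 by simp
  then have "2 ^ n * fact n * descent_poly n t
      = (\<Sum>i\<le>2 * n. of_real (coeff (rising_poly n) i) * pow_series t i) * (1 - t) ^ Suc (2 * n)"
    using t1 by (simp add: field_simps)
  also have "\<dots> = (\<Sum>i\<le>2 * n. of_real (coeff (rising_poly n) i * fact i) * (1 - t) ^ (2 * n - i) * shifted_eulerian t i 0)"
    unfolding sum_distrib_right
  proof (rule sum.cong)
    fix i assume "i \<in> {..2 * n}"
    then have "(1 - t) ^ Suc (2 * n) = (1 - t) ^ (2 * n - i) * (1 - t) ^ Suc i"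
      by (simp flip: power_add)
    then show "of_real (coeff (rising_poly n) i) * pow_series t i * (1 - t) ^ Suc (2 * n)
        = of_real (coeff (rising_poly n) i * fact i) * (1 - t) ^ (2 * n - i) * shifted_eulerian t i 0"
      by (simp add: shifted_eulerian_at_0)
  qed simp
  finally show ?thesis .
qed

text \<open>For \<open>n > 0\<close> the probability generating function of the number of descents:
  \<open>normalized_descent_poly_1\<close> identifies the prefactor as the reciprocal of the number
  of matchings.\<close>

definition normalized_descent_poly :: "nat \<Rightarrow> complex \<Rightarrow> complex" where
  "normalized_descent_poly n t = 2 ^ n * fact n / fact (2 * n) * descent_poly n t"

text \<open>Adding the leading term gives \<open>y ^ (2 * n)\<close> times the polynomial at
  \<open>1 / y\<close>. Spread over the factors this is the product of
  \<open>1 + y + 2 * k * y\<^sup>2\<close>, and \<open>1 + x \<le> exp x\<close> applies to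
  each.\<close>

lemma rising_poly_tail_le:
  assumes "y > 0"
  shows "(\<Sum>i<2 * n. coeff (rising_poly n) i * y ^ (2 * n - i)) \<le> exp (real n * y + (real n * y)\<^sup>2) - 1"
proof -
  have "1 + (\<Sum>i<2 * n. coeff (rising_poly n) i * y ^ (2 * n - i))
      = (\<Sum>i\<le>2 * n. coeff (rising_poly n) i * y ^ (2 * n - i))"
    by (simp add: lead_coeff_rising_poly flip: lessThan_Suc_atMost)
  also have "\<dots> = y ^ (2 * n) * poly (rising_poly n) (1 / y)"
    unfolding poly_rising_poly_sum sum_distrib_left
    using assms by (intro sum.cong) (auto simp: power_diff power_divide)
  also have "\<dots> = (\<Prod>k<n. y\<^sup>2 * ((1 / y)\<^sup>2 + 1 / y + 2 * real k))"
    by (simp add: poly_rising_poly prod.distrib power_mult)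
  also have "\<dots> = (\<Prod>k<n. 1 + (y + 2 * real k * y\<^sup>2))"
    using assms by (intro prod.cong) (auto simp: field_simps power2_eq_square)
  also have "\<dots> \<le> (\<Prod>k<n. exp (y + 2 * real k * y\<^sup>2))"
    using assms by (intro prod_mono) (auto intro!: add_nonneg_nonneg)
  also have "\<dots> = exp (\<Sum>k<n. y + 2 * real k * y\<^sup>2)"
    by (simp add: exp_sum)
  also have "(\<Sum>k<n. y + 2 * real k * y\<^sup>2) \<le> real n * y + (real n * y)\<^sup>2"
  proof (induction n)
    case (Suc n)
    have "(\<Sum>k<Suc n. y + 2 * real k * y\<^sup>2)
        \<le> (real n * y + (real n * y)\<^sup>2) + (y + (2 * real n + 1) * y\<^sup>2)"
      unfolding sum.lessThan_Suc by (intro add_mono Suc.IH order_refl mult_right_mono) auto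
    also have "\<dots> = real (Suc n) * y + (real (Suc n) * y)\<^sup>2"
      by (simp add: algebra_simps power2_eq_square)
    finally show ?case .
  qed simp
  finally show ?thesis by simp
qed

text \<open>The subtracted term is the one of degree \<open>2 * n\<close>. In the others the
  Eulerian factor has norm at most 1, and \<open>fact_ratio_le\<close> bounds the factorial
  quotient, which gives \<open>y\<close> its constant.\<close>

lemma normalized_descent_poly_approx_eulerian:
  assumes "norm t < 1" "n > 0"
  defines "y \<equiv> exp 1 / (2 * real n) * norm (1 - t)"
  shows "norm (normalized_descent_poly n t - shifted_eulerian t (2 * n) 0)
    \<le> exp (real n * y + (real n * y)\<^sup>2) - 1"
proof -
  have "t \<noteq> 1" using assms(1) by auto
  then have y: "y > 0" using assms(2) by (simp add: y_def)
  let ?c = "coeff (rising_poly n)"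
  let ?h = "\<lambda>i. shifted_eulerian t i 0"
  have "normalized_descent_poly n t = (2 ^ n * fact n * descent_poly n t) / fact (2 * n)"
    by (simp add: normalized_descent_poly_def)
  also have "\<dots> = ?h (2 * n) + (\<Sum>i<2 * n. of_real (?c i * (fact i / fact (2 * n))) * (1 - t) ^ (2 * n - i) * ?h i)"
    unfolding descent_poly_expansion[OF assms(1)]
    by (simp add: lead_coeff_rising_poly add_divide_distrib sum_divide_distrib flip: lessThan_Suc_atMost)
  finally have "norm (normalized_descent_poly n t - ?h (2 * n))
      = norm (\<Sum>i<2 * n. of_real (?c i * (fact i / fact (2 * n))) * (1 - t) ^ (2 * n - i) * ?h i)"
    by simp
  also have "\<dots> \<le> (\<Sum>i<2 * n. ?c i * y ^ (2 * n - i))"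
  proof (rule sum_norm_le)
    fix i assume i: "i \<in> {..<2 * n}"
    have "norm (of_real (?c i * (fact i / fact (2 * n))) * (1 - t) ^ (2 * n - i) * ?h i)
        = ?c i * (fact i / fact (2 * n)) * norm (1 - t) ^ (2 * n - i) * norm (?h i)"
      using coeff_rising_poly_nonneg[of n i] by (simp add: norm_mult norm_power norm_divide)
    also have "\<dots> \<le> ?c i * (exp 1 / real (2 * n)) ^ (2 * n - i) * norm (1 - t) ^ (2 * n - i) * 1"
      using fact_ratio_le[of i "2 * n"] norm_shifted_eulerian_le_1[OF assms(1), of 0 i] i assms(2)
      by (intro mult_mono mult_nonneg_nonneg coeff_rising_poly_nonneg order_refl) auto
    also have "\<dots> = ?c i * y ^ (2 * n - i)"
      by (simp only: y_def power_mult_distrib of_nat_mult of_nat_numeral mult.assoc mult_1_right)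
    finally show "norm (of_real (?c i * (fact i / fact (2 * n))) * (1 - t) ^ (2 * n - i) * ?h i)
        \<le> ?c i * y ^ (2 * n - i)" .
  qed
  also have "\<dots> \<le> exp (real n * y + (real n * y)\<^sup>2) - 1"
    by (rule rising_poly_tail_le[OF y])
  finally show ?thesis .
qed

text \<open>A bound independent of \<open>n\<close> and vanishing at 0: \<open>2 * x\<close> covers
  \<open>shifted_eulerian_approx\<close>, the exponential part the lower-order terms, where
  \<open>real n * y \<le> exp 1 * x / 2\<close>.\<close>

definition descent_error :: "real \<Rightarrow> real" where
  "descent_error x = 2 * x + (exp (exp 1 * x / 2 + (exp 1 * x / 2)\<^sup>2) - 1)"

lemma normalized_descent_poly_approx_right:
  assumes "Re z > 0" "n > 0"
  shows "norm (normalized_descent_poly n (exp (- z)) - ((1 - exp (- z)) / z) ^ Suc (2 * n))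
    \<le> descent_error (norm z)"
proof -
  define t where "t = exp (- z)"
  define y where "y = exp 1 / (2 * real n) * norm (1 - t)"
  have nt: "norm t < 1" using assms by (simp add: t_def)
  have le: "norm (1 - t) \<le> norm z"
    unfolding t_def using assms by (intro norm_one_minus_exp_le) auto
  have ny: "real n * y \<le> exp 1 * norm z / 2" "real n * y \<ge> 0"
    using le assms by (auto simp: y_def)
  have "norm (normalized_descent_poly n t - ((1 - t) / z) ^ Suc (2 * n))
      \<le> norm (normalized_descent_poly n t - shifted_eulerian t (2 * n) 0)
        + norm (((1 - t) / z) ^ Suc (2 * n) - shifted_eulerian t (2 * n) 0)"
    unfolding dist_norm[symmetric] by (rule dist_triangle2)
  also have "\<dots> \<le> (exp (real n * y + (real n * y)\<^sup>2) - 1) + (norm (1 - t) + norm z)"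
    unfolding y_def using nt assms
    by (intro add_mono normalized_descent_poly_approx_eulerian shifted_eulerian_approx) (auto simp: t_def)
  also have "\<dots> \<le> (exp (exp 1 * norm z / 2 + (exp 1 * norm z / 2)\<^sup>2) - 1) + (norm z + norm z)"
    using ny le by (intro add_mono diff_mono order_refl) (auto intro!: add_mono power_mono)
  finally show ?thesis by (simp add: descent_error_def t_def)
qed

section \<open>Passage to the boundary of the unit disc\<close>

lemma isCont_normalized_descent_poly: "isCont (normalized_descent_poly n) t"
  unfolding normalized_descent_poly_def[abs_def] descent_poly_def[abs_def]
  by (intro continuous_intros)

lemma descent_error_tendsto: "(f \<longlongrightarrow> a) F \<Longrightarrow> ((\<lambda>x. descent_error (f x)) \<longlongrightarrow> descent_error a) F"
  unfolding descent_error_def by (intro tendsto_intros) auto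

text \<open>The series need \<open>norm t < 1\<close>, but both sides of the resulting bound are
  continuous in \<open>z\<close> away from 0, so it extends to the imaginary axis by approach from
  the right.\<close>

lemma normalized_descent_poly_approx:
  assumes "Re z \<ge> 0" "z \<noteq> 0" "n > 0"
  shows "norm (normalized_descent_poly n (exp (- z)) - ((1 - exp (- z)) / z) ^ Suc (2 * n))
    \<le> descent_error (norm z)"
proof (rule LIMSEQ_le)
  define u where "u = (\<lambda>k. z + of_real (inverse (real (Suc k))))"
  have "(\<lambda>k. of_real (inverse (real (Suc k))) :: complex) \<longlonglongrightarrow> of_real 0"
    by (intro tendsto_of_real LIMSEQ_inverse_real_of_nat)
  then have u: "u \<longlonglongrightarrow> z"
    unfolding u_def using tendsto_add[OF tendsto_const[of z]] by fastforce
  show "(\<lambda>k. norm (normalized_descent_poly n (exp (- u k)) - ((1 - exp (- u k)) / u k) ^ Suc (2 * n)))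
      \<longlonglongrightarrow> norm (normalized_descent_poly n (exp (- z)) - ((1 - exp (- z)) / z) ^ Suc (2 * n))"
    by (intro tendsto_intros u isCont_tendsto_compose[OF isCont_normalized_descent_poly] assms)
  show "(\<lambda>k. descent_error (norm (u k))) \<longlonglongrightarrow> descent_error (norm z)"
    by (intro descent_error_tendsto tendsto_norm u)
  have "Re (u k) > 0" for k
  proof -
    have "Re (u k) = Re z + inverse (real (Suc k))" by (simp add: u_def del: of_nat_Suc of_real_inverse)
    then show ?thesis using assms(1) by (simp add: add_nonneg_pos)
  qed
  then show "\<exists>N. \<forall>k\<ge>N. norm (normalized_descent_poly n (exp (- u k)) - ((1 - exp (- u k)) / u k) ^ Suc (2 * n))
      \<le> descent_error (norm (u k))"
    using normalized_descent_poly_approx_right assms(3) by blast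
qed

text \<open>Taking \<open>z\<close> to \<open>0\<close> in the approximation counts the matchings:
  there are \<open>(2 n)! / (2 ^ n n!)\<close> of them.\<close>

lemma normalized_descent_poly_1:
  assumes "n > 0"
  shows "normalized_descent_poly n 1 = 1"
proof -
  define u where "u = (\<lambda>k. of_real (inverse (real (Suc k))) :: complex)"
  have "u \<longlonglongrightarrow> of_real 0"
    unfolding u_def by (intro tendsto_of_real LIMSEQ_inverse_real_of_nat)
  then have u: "u \<longlonglongrightarrow> 0" by simp
  have u0: "u k \<noteq> 0" "Re (u k) > 0" for k
    by (simp_all add: u_def del: of_nat_Suc of_real_inverse)
  have "(\<lambda>h. (exp (0 + h) - exp (0::complex)) / h) \<midarrow>0\<rightarrow> exp 0"
    using DERIV_exp[of "0::complex"] unfolding DERIV_def .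
  then have "(\<lambda>k. (exp (0 + (- u k)) - exp 0) / (- u k)) \<longlonglongrightarrow> exp 0"
    by (rule filterlim_compose)
       (use u u0 in \<open>auto simp: filterlim_at intro!: tendsto_eq_intros\<close>)
  moreover have "(exp (0 + (- u k)) - exp 0) / (- u k) = (1 - exp (- u k)) / u k" for k
    using u0(1)[of k] by (simp add: field_simps)
  ultimately have q: "(\<lambda>k. (1 - exp (- u k)) / u k) \<longlonglongrightarrow> 1"
    by simp
  have "(\<lambda>k. norm (normalized_descent_poly n (exp (- u k)) - ((1 - exp (- u k)) / u k) ^ Suc (2 * n)))
      \<longlonglongrightarrow> norm (normalized_descent_poly n (exp (- 0)) - 1 ^ Suc (2 * n))"
    by (intro tendsto_intros u q isCont_tendsto_compose[OF isCont_normalized_descent_poly])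
  moreover have "(\<lambda>k. descent_error (norm (u k))) \<longlonglongrightarrow> descent_error (norm (0::complex))"
    by (intro descent_error_tendsto tendsto_norm u)
  ultimately have "norm (normalized_descent_poly n (exp (- 0)) - 1 ^ Suc (2 * n)) \<le> descent_error (norm (0::complex))"
    by (rule LIMSEQ_le) (use normalized_descent_poly_approx_right u0 assms in blast)
  then show ?thesis by (simp add: descent_error_def)
qed

subsection \<open>Characteristic functions\<close>

text \<open>With \<open>x = a / (2 * sqrt n)\<close>, \<open>ln (sin x / x)\<close> is about
  \<open>- x\<^sup>2 / 6 = - a\<^sup>2 / (24 * n)\<close>; the exponent \<open>2 * n + 1\<close>
  turns this into \<open>- a\<^sup>2 / 12\<close>.\<close>

lemma sinc_power_tendsto_pos:
  fixes a :: real
  assumes a: "a > 0"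
  shows "(\<lambda>n. (sin (a / sqrt (real n) / 2) / (a / sqrt (real n) / 2)) ^ Suc (2 * n)) \<longlonglongrightarrow> exp (- a\<^sup>2 / 12)"
proof -
  define q where "q = (\<lambda>n. sin (a / sqrt (real n) / 2) / (a / sqrt (real n) / 2))"
  have pos: "eventually (\<lambda>n. q n > 0) sequentially"
    unfolding q_def using a by real_asymp
  have "(\<lambda>n. (2 * real n + 1) * ln (q n)) \<longlonglongrightarrow> - a\<^sup>2 / 12"
    unfolding q_def using a by (real_asymp, simp add: power2_eq_square)
  then have "(\<lambda>n. exp ((2 * real n + 1) * ln (q n))) \<longlonglongrightarrow> exp (- a\<^sup>2 / 12)"
    by (rule tendsto_exp)
  moreover have "eventually (\<lambda>n. exp ((2 * real n + 1) * ln (q n)) = q n ^ Suc (2 * n)) sequentially"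
    using pos
  proof eventually_elim
    case (elim n)
    have "2 * real n + 1 = real (Suc (2 * n))" by simp
    then show ?case using elim by (simp only: exp_of_nat_mult exp_ln)
  qed
  ultimately have "(\<lambda>n. q n ^ Suc (2 * n)) \<longlonglongrightarrow> exp (- a\<^sup>2 / 12)"
    by (rule Lim_transform_eventually)
  then show ?thesis by (simp only: q_def)
qed

lemma sinc_power_tendsto:
  fixes \<theta> :: real
  assumes "\<theta> \<noteq> 0"
  shows "(\<lambda>n. (sin (\<theta> / sqrt (real n) / 2) / (\<theta> / sqrt (real n) / 2)) ^ Suc (2 * n)) \<longlonglongrightarrow> exp (- \<theta>\<^sup>2 / 12)"
proof (cases "\<theta> > 0")
  case False
  then have "- \<theta> > 0" using assms by simp
  from sinc_power_tendsto_pos[OF this] show ?thesis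
    by (simp only: minus_divide_left[symmetric] minus_divide_right[symmetric] minus_minus sin_minus power2_minus)
qed (rule sinc_power_tendsto_pos)

lemma char_normal:
  assumes "\<sigma> > 0"
  shows "char (density lborel (normal_density 0 \<sigma>)) \<theta> = of_real (exp (- (\<sigma> * \<theta>)\<^sup>2 / 2))"
proof -
  let ?D = "density lborel (normal_density 0 \<sigma>)"
  interpret D: prob_space ?D using assms by (rule prob_space_normal_density)
  have "distributed ?D lborel (\<lambda>x. x) (normal_density 0 \<sigma>)"
    by (auto simp: distributed_def distr_id2)
  then have "distributed ?D lborel (\<lambda>x. (x - 0) / \<sigma>) std_normal_density"
    using D.normal_standard_normal_convert[OF assms, where X = "\<lambda>x. x" and \<mu> = 0] by simp
  then have "distr ?D lborel (\<lambda>x. x / \<sigma>) = std_normal_distribution"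
    by (simp add: distributed_def)
  then have "char std_normal_distribution (\<sigma> * \<theta>) = (CLINT x|distr ?D lborel (\<lambda>x. x / \<sigma>). iexp (\<sigma> * \<theta> * x))"
    by (simp add: char_def)
  also have "\<dots> = (CLINT x|?D. iexp (\<sigma> * \<theta> * (x / \<sigma>)))"
    by (rule integral_distr) auto
  also have "\<dots> = char ?D \<theta>"
    using assms by (simp add: char_def)
  finally show ?thesis by (simp add: char_std_normal_distribution)
qed

lemma iexp_add_of_nat_mult: "iexp (a + real k * c) = iexp a * iexp c ^ k"
proof -
  have "\<i> * of_real (a + real k * c) = \<i> * of_real a + of_nat k * (\<i> * of_real c)"
    by (simp add: algebra_simps)
  then show ?thesis by (simp only: exp_add exp_of_nat_mult)
qed

lemma char_W:
  assumes "n > 0"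
  shows "char (distr (measure_pmf (pmf_of_set (matchings n))) borel (W n)) \<theta>
    = iexp (- \<theta> * sqrt n) * normalized_descent_poly n (iexp (\<theta> / sqrt n))"
proof -
  let ?t = "iexp (\<theta> / sqrt n)"
  have s: "real n / sqrt (real n) = sqrt (real n)" by (rule real_div_sqrt) simp
  have "iexp (\<theta> * W n p) = iexp (- \<theta> * sqrt n) * ?t ^ num_descents (2 * n) p" for p
  proof -
    have "\<theta> * W n p = - \<theta> * sqrt n + real (num_descents (2 * n) p) * (\<theta> / sqrt n)"
      unfolding W_def diff_divide_distrib s by (simp add: algebra_simps)
    then show ?thesis by (simp only: iexp_add_of_nat_mult)
  qed
  then have "(\<Sum>p\<in>matchings n. iexp (\<theta> * W n p)) = iexp (- \<theta> * sqrt n) * descent_poly n ?t"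
    by (simp add: descent_poly_def sum_distrib_left)
  moreover have "char (distr (measure_pmf (pmf_of_set (matchings n))) borel (W n)) \<theta>
      = (\<Sum>p\<in>matchings n. iexp (\<theta> * W n p)) / card (matchings n)"
  proof -
    have "(CLINT p|measure_pmf (pmf_of_set (matchings n)). g p) = sum g (matchings n) / card (matchings n)" for g
      by (subst integral_measure_pmf[OF finite_matchings[of n]])
         (simp_all add: matchings_nonempty finite_matchings scaleR_conv_of_real sum_divide_distrib)
    then show ?thesis unfolding char_def by (subst integral_distr) simp_all
  qed
  \<comment> \<open>At \<open>t = 1\<close> every power is 1, so the normalization reveals the
    number of matchings.\<close>
  moreover have "of_nat (card (matchings n)) * (2 ^ n * fact n / fact (2 * n)) = (1 :: complex)"
    using normalized_descent_poly_1[OF assms]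
    by (simp add: normalized_descent_poly_def descent_poly_def mult.commute)
  then have "2 ^ n * fact n / fact (2 * n) = 1 / (of_nat (card (matchings n)) :: complex)"
    by (metis mult_zero_left nonzero_mult_div_cancel_left zero_neq_one)
  ultimately show ?thesis
    unfolding normalized_descent_poly_def by simp
qed

text \<open>Taking out the half-angle phase leaves a real factor. The quotient is
  \<open>(1 - exp (- z)) / z\<close> at \<open>z = - \<i> * \<alpha>\<close>, the base of the main
  term of the approximation.\<close>

lemma one_minus_iexp_quotient:
  fixes \<alpha> :: real
  assumes "\<alpha> \<noteq> 0"
  shows "(1 - iexp \<alpha>) / (- \<i> * \<alpha>) = iexp (\<alpha> / 2) * of_real (sin (\<alpha> / 2) / (\<alpha> / 2))"
proof -
  have "iexp \<alpha> = iexp (\<alpha> / 2) * iexp (\<alpha> / 2)"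
    by (simp flip: exp_add) 
  moreover have "1 = iexp (\<alpha> / 2) * iexp (- (\<alpha> / 2))"
    by (simp flip: exp_add)
  moreover have "iexp (- (\<alpha> / 2)) - iexp (\<alpha> / 2) = - 2 * \<i> * of_real (sin (\<alpha> / 2))"
    by (simp add: complex_eq_iff Re_exp Im_exp)
  ultimately have *: "1 - iexp \<alpha> = iexp (\<alpha> / 2) * (- 2 * \<i> * of_real (sin (\<alpha> / 2)))"
    by (metis right_diff_distrib)
  show ?thesis unfolding * using assms by (simp add: field_simps)
qed

theorem theorem4p3:
  shows "weak_conv_m
    (\<lambda>n. distr (measure_pmf (pmf_of_set (matchings n))) borel (W n))
    (density lborel (normal_density 0 (sqrt (1 / 6))))"
proof (rule levy_continuity)
  fix n
  interpret prob_space "distr (measure_pmf (pmf_of_set (matchings n))) borel (W n)"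
    by (rule measure_pmf.prob_space_distr) simp
  show "real_distribution (distr (measure_pmf (pmf_of_set (matchings n))) borel (W n))"
    by unfold_locales auto
next
  interpret prob_space "density lborel (normal_density 0 (sqrt (1 / 6)))"
    by (rule prob_space_normal_density) simp
  show "real_distribution (density lborel (normal_density 0 (sqrt (1 / 6))))"
    by unfold_locales auto
next
  fix \<theta> :: real
  let ?M = "\<lambda>n. distr (measure_pmf (pmf_of_set (matchings n))) borel (W n)"
  have target: "char (density lborel (normal_density 0 (sqrt (1 / 6)))) \<theta> = of_real (exp (- \<theta>\<^sup>2 / 12))"
    by (subst char_normal) (simp_all add: power_mult_distrib real_sqrt_pow2)
  show "(\<lambda>n. char (?M n) \<theta>) \<longlonglongrightarrow> char (density lborel (normal_density 0 (sqrt (1 / 6)))) \<theta>"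
  proof (cases "\<theta> = 0")
    case True
    \<comment> \<open>The approximation requires \<open>z \<noteq> 0\<close>, so
      \<open>\<theta> = 0\<close> is separate; here the generating function is evaluated at
      1.\<close>
    have "eventually (\<lambda>n. char (?M n) \<theta> = 1) sequentially"
      using eventually_gt_at_top[of 0]
      by eventually_elim (simp add: True char_W normalized_descent_poly_1)
    then show ?thesis unfolding target by (simp add: True tendsto_eventually)
  next
    case False
    define \<alpha> where "\<alpha> = (\<lambda>n. \<theta> / sqrt (real n))"
    define E where "E = (\<lambda>n. ((1 - iexp (\<alpha> n)) / (- \<i> * \<alpha> n)) ^ Suc (2 * n))"
    have \<alpha>0: "\<alpha> \<longlonglongrightarrow> 0" unfolding \<alpha>_def by real_asymp
    have "(\<lambda>n. descent_error \<bar>\<alpha> n\<bar>) \<longlonglongrightarrow> descent_error \<bar>0\<bar>"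
      by (intro descent_error_tendsto tendsto_rabs \<alpha>0)
    then have err: "(\<lambda>n. descent_error \<bar>\<alpha> n\<bar>) \<longlonglongrightarrow> 0" by (simp add: descent_error_def)
    \<comment> \<open>The approximation at \<open>z = - \<i> * \<alpha> n\<close> bounds the
      difference, and the phase has norm 1.\<close>
    have "(\<lambda>n. iexp (- \<theta> * sqrt n) * (normalized_descent_poly n (iexp (\<alpha> n)) - E n)) \<longlonglongrightarrow> 0"
    proof (rule Lim_null_comparison[OF _ err])
      show "eventually (\<lambda>n. norm (iexp (- \<theta> * sqrt n) * (normalized_descent_poly n (iexp (\<alpha> n)) - E n))
          \<le> descent_error \<bar>\<alpha> n\<bar>) sequentially"
        using eventually_gt_at_top[of 0]
      proof eventually_elim
        case (elim n)
        then have "- \<i> * \<alpha> n \<noteq> 0" using False by (simp add: \<alpha>_def)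
        then show ?case
          using normalized_descent_poly_approx[of "- \<i> * \<alpha> n" n] elim
          by (simp add: E_def norm_mult)
      qed
    qed
    moreover have "(\<lambda>n. iexp (- \<theta> * sqrt n) * E n) \<longlonglongrightarrow> of_real (exp (- \<theta>\<^sup>2 / 12))"
    proof -
      have "(\<lambda>n. iexp (\<alpha> n / 2) * of_real ((sin (\<alpha> n / 2) / (\<alpha> n / 2)) ^ Suc (2 * n)))
          \<longlonglongrightarrow> iexp (0 / 2) * of_real (exp (- \<theta>\<^sup>2 / 12))"
        using sinc_power_tendsto[OF False] unfolding \<alpha>_def[symmetric, THEN fun_cong]
        by (intro tendsto_intros \<alpha>0) (simp_all add: \<alpha>_def)
      then have "(\<lambda>n. iexp (\<alpha> n / 2) * of_real ((sin (\<alpha> n / 2) / (\<alpha> n / 2)) ^ Suc (2 * n)))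
          \<longlonglongrightarrow> of_real (exp (- \<theta>\<^sup>2 / 12))" by simp
      \<comment> \<open>Of the \<open>2 * n + 1\<close> half-angle phases in \<open>E n\<close>,
        \<open>2 * n\<close> cancel the centering phase \<open>iexp (- \<theta> * sqrt n)\<close>;
        the single one left tends to 1.\<close>
      moreover have "eventually (\<lambda>n. iexp (\<alpha> n / 2) * of_real ((sin (\<alpha> n / 2) / (\<alpha> n / 2)) ^ Suc (2 * n))
          = iexp (- \<theta> * sqrt n) * E n) sequentially"
        using eventually_gt_at_top[of 0]
      proof eventually_elim
        case (elim n)
        then have \<alpha>n: "\<alpha> n \<noteq> 0" using False by (simp add: \<alpha>_def)
        have "real n / sqrt (real n) = sqrt (real n)" by (rule real_div_sqrt) simp
        then have n\<alpha>: "real n * \<alpha> n = \<theta> * sqrt n"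
          unfolding \<alpha>_def by (metis mult.commute times_divide_eq_left times_divide_eq_right)
        have "real (Suc (2 * n)) * (\<alpha> n / 2) = real n * \<alpha> n + \<alpha> n / 2"
          by (simp add: field_simps)
        then have "- \<theta> * sqrt n + real (Suc (2 * n)) * (\<alpha> n / 2) = \<alpha> n / 2"
          unfolding n\<alpha> by linarith
        then have "iexp (\<alpha> n / 2) = iexp (- \<theta> * sqrt n) * iexp (\<alpha> n / 2) ^ Suc (2 * n)"
          by (simp only: iexp_add_of_nat_mult[symmetric])
        then show ?case
          unfolding E_def one_minus_iexp_quotient[OF \<alpha>n] power_mult_distrib
          by (simp only: of_real_power mult.assoc[symmetric])
      qed
      ultimately show ?thesis by (rule Lim_transform_eventually)
    qed
    ultimately have "(\<lambda>n. iexp (- \<theta> * sqrt n) * (normalized_descent_poly n (iexp (\<alpha> n)) - E n)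
        + iexp (- \<theta> * sqrt n) * E n) \<longlonglongrightarrow> 0 + of_real (exp (- \<theta>\<^sup>2 / 12))"
      by (rule tendsto_add)
    then have "(\<lambda>n. iexp (- \<theta> * sqrt n) * normalized_descent_poly n (iexp (\<alpha> n)))
        \<longlonglongrightarrow> of_real (exp (- \<theta>\<^sup>2 / 12))"
      by (simp add: algebra_simps)
    then show ?thesis
      unfolding target
      by (rule Lim_transform_eventually)
         (use eventually_gt_at_top[of 0] in \<open>eventually_elim, simp add: char_W \<alpha>_def\<close>)
  qed
qed

end
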